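(* Let $1\le k\le r$ and let $a\colon\mathcal F\to(0,\infty)$, $b\colon\mathcal F\to[0,\infty)$ satisfy the condition $\mathrm{NC}_k$, where $\mathcal F$ is the set of front faces of $[0,1]^r$. Assume further that $b$ is increasing. Then there exist some $t\in(0,1)$ and a sequence $z_n\in C_k(t\mathbf 1)$, $n\ge1$, where $\mathbf 1=(1,\dots,1)$, such that $c^\infty=\operatorname{tnest}((z_n)_{n\ge1})$ satisfies $\operatorname{tchar}_{c^\infty}=(a,b)$.
   Context: Faces. Let $V=\{0,1\}^r$. For $\nu\in V$, $F(\nu)=\{u\in[0,1]^r: u_i=0\text{ if }\nu_i=0\}$ is a front face, of dimension $\sum_i\nu_i$; $\mathcal F=\{F(\nu):\nu\in V\}$; each $F\in\mathcal F$ is identified with $[0,1]^{\dim F}$. Put $\hat\nu=\mathbf 1-\nu$; the complementary front face of $F(\nu)$ is $F(\nu)^c=F(\hat\nu)$. $\pi^F\colon[0,1]^r\to F^c$ is the coordinate projection along $F$; the same symbol denotes push-forward of measures. For a measure $c$ on $[0,1]^r$, $c_F=\pi^{F^c}(c)$ is its push-forward to $F$. Conditions on maps. A map $b$ on $\mathcal F$ is increasing if $b(F)<b(F')$ whenever $F\subset F'$, $F\neq F'$; it is eventually constant at $F$ if $b(F)=b(F')$ for each $F'\in\mathcal F$ with $F\subset F'$, $F'\ne F$. The pair $a,b$ satisfies $\mathrm{NC}_k$ if: (i) $b(F')\ge b(F)$ whenever $F'\supset F$; (ii) $(a(F),b(F))=(1,\dim F)$ for each $F\in\mathcal F$ with $\dim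 F\le k$; (iii) if $b$ is eventually constant at $F$, then $\sum_{F'\supset F}(-1)^{\dim F'-\dim F}a(F')\ge0$. Tail characteristic. For a copula $c$ (a Borel probability measure on $[0,1]^r$ with uniform one-dimensional marginals) and $F\in\mathcal F$ let $\operatorname{tdeg}_c(F)=\inf\{\tau\in\mathbb R:\liminf_{s\to0}c_F(s[0,1]^{\dim F})/s^\tau=\infty\}$ and, if this is finite, $\operatorname{tcoef}_c(F)=\liminf_{s\to0}c_F(s[0,1]^{\dim F})/s^{\operatorname{tdeg}_c(F)}$ (and $\operatorname{tcoef}_c(F)=0$ otherwise); $\operatorname{tchar}_c=(\operatorname{tcoef}_c,\operatorname{tdeg}_c)$. Vertex copulas. A copula of order $k$ is a Borel probability measure on $[0,1]^r$ whose push-forward to each front face of dimension $k$ is uniform. For $u\in(0,1)^r$ decompose $[0,1]^r$ into the $2^r$ boxes $J_\nu=\prod_iK_i$, $\nu\in V$, with $K_i=[0,u_i]$ if $\nu_i=0$ and $K_i=[u_i,1]$ if $\nu_i=1$. Via $u$, $z\in\mathbb R^V$ is identified with the signed measure that is uniform on each $J_\nu$ with mass $z(\nu)$ there. $C_k(u)$ is the set of $z\in[0,1]^V$ whose associated measure is a copula of order $k$ (vertex copulas of order $k$). Tail nesting. A grid decomposition $\mathcal J$ of $[0,1]^r$ is a product of finite decompositions of $[0,1]$ into compact intervals of positive length with disjoint interiors; a grid copula is a copula uniform on each box of some grid. For $J=\prod_iJ_i\in\mathcal J$ let $\nu_J\in V$ be given by $(\nu_J)_i=0$ if $0\in J_i$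 and $(\nu_J)_i=1$ otherwise, and let $\imath_J\colon[0,1]^r\to J$ be the coordinatewise increasing affine bijection. For $z\in C_k(u)$ and $\nu\in V$ let $z^{(\nu)}=\pi^{F(\nu)}(z)\times\mathrm{cu}_{F(\nu)}$ be the product of the push-forward of $z$ to $F(\hat\nu)$ with the uniform probability measure on $F(\nu)$. For a grid copula $c$ of order $k$ with grid $\mathcal J$, $\operatorname{tnest}(z,c)$ is obtained from $c$ by replacing, for each $J\in\mathcal J$, $c|_J$ by $c(J)\cdot(\imath_J)_*z^{(\nu_J)}$; its grid is obtained by subdividing each $J$ into the boxes $\imath_J(J_\nu)$. For $z_n\in C_k(u^{(n)})$ put $c^1=z_1$, $c^n=\operatorname{tnest}(z_n,c^{n-1})$; $\operatorname{tnest}((z_n)_{n\ge1})=c^\infty$ is the limit (weak limit, which exists) of $(c^n)$. *)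

theory Defs
  imports "HOL-Probability.Probability"
begin

text \<open>
  The dimension \<open>r\<close> is \<open>CARD('r)\<close>. A vertex \<open>\<nu>\<close> of \<open>{0,1}\<^sup>r\<close> is represented by the set of
  indices \<open>i\<close> with \<open>\<nu>\<^sub>i = 1\<close>, so that the complementary vertex is \<open>- \<nu>\<close>.
\<close>

type_synonym 'r vertex = "'r set"

definition unit_cube :: "(real^'r) set" where
  "unit_cube = cbox 0 1"

definition front_face :: "'r::finite vertex \<Rightarrow> (real^'r) set" where
  "front_face \<nu> = {u \<in> unit_cube. \<forall>i. i \<notin> \<nu> \<longrightarrow> u $ i = 0}"

definition front_faces :: "(real^'r::finite) set set" where
  "front_faces = range front_face"

text \<open>The inverse of \<^const>\<open>front_face\<close>.\<close>

definition face_vertex :: "(real^'r::finite) set \<Rightarrow> 'r vertex" where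
  "face_vertex F = {i. \<exists>u\<in>F. u $ i \<noteq> 0}"

definition compl_face :: "(real^'r::finite) set \<Rightarrow> (real^'r) set" where
  "compl_face F = front_face (- face_vertex F)"

text \<open>
  The dimension of a face is the library's \<^const>\<open>dim\<close> (dimension of the linear span); all front
  faces contain the origin.
\<close>

lemma face_vertex_front_face [simp]: "face_vertex (front_face \<nu>) = \<nu>"
proof -
  have "axis i 1 \<in> front_face \<nu>" if "i \<in> \<nu>" for i
    using that by (auto simp: front_face_def unit_cube_def mem_box_cart axis_def)
  then show ?thesis
    by (fastforce simp: face_vertex_def front_face_def axis_def)
qed

lemma dim_front_face [simp]: "dim (front_face \<nu>) = card \<nu>"
proof -
  let ?B = "(\<lambda>i. axis i (1::real)) ` \<nu>"
  have 1: "?B \<subseteq> front_face \<nu>"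
    by (auto simp: front_face_def unit_cube_def mem_box_cart axis_def)
  have 2: "front_face \<nu> \<subseteq> span ?B"
  proof
    fix x assume x: "x \<in> front_face \<nu>"
    have "(\<Sum>i\<in>\<nu>. x $ i *\<^sub>R axis i (1::real)) \<in> span ?B"
      by (intro span_sum span_scale span_base) auto
    moreover have "(\<Sum>i\<in>\<nu>. x $ i *\<^sub>R axis i (1::real)) = x"
    proof (rule vec_eq_iff[THEN iffD2], intro allI)
      fix j
      have "(\<Sum>i\<in>\<nu>. x $ i *\<^sub>R axis i (1::real)) $ j = (\<Sum>i\<in>\<nu>. if i = j then x $ i else 0)"
        unfolding sum_component by (intro sum.cong) (auto simp: axis_def)
      also have "\<dots> = x $ j"
        using x by (auto simp: front_face_def)
      finally show "(\<Sum>i\<in>\<nu>. x $ i *\<^sub>R axis i (1::real)) $ j = x $ j" .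
    qed
    ultimately show "x \<in> span ?B" by simp
  qed
  have 3: "independent ?B"
    by (rule independent_mono[OF independent_Basis]) (auto simp: Basis_vec_def)
  have "card ?B = card \<nu>"
    by (rule card_image) (auto simp: inj_on_def axis_eq_axis)
  with dim_unique[OF 1 2 3] show ?thesis by simp
qed

definition increasing_on_faces :: "((real^'r::finite) set \<Rightarrow> real) \<Rightarrow> bool" where
  "increasing_on_faces b \<longleftrightarrow> (\<forall>F\<in>front_faces. \<forall>F'\<in>front_faces. F \<subset> F' \<longrightarrow> b F < b F')"

definition eventually_constant_at ::
    "((real^'r::finite) set \<Rightarrow> real) \<Rightarrow> (real^'r) set \<Rightarrow> bool" where
  "eventually_constant_at b F \<longleftrightarrow> (\<forall>F'\<in>front_faces. F \<subset> F' \<longrightarrow> b F = b F')"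

definition NC ::
    "nat \<Rightarrow> ((real^'r::finite) set \<Rightarrow> real) \<Rightarrow> ((real^'r) set \<Rightarrow> real) \<Rightarrow> bool" where
  "NC k a b \<longleftrightarrow>
     (\<forall>F\<in>front_faces. \<forall>F'\<in>front_faces. F \<subseteq> F' \<longrightarrow> b F \<le> b F') \<and>
     (\<forall>F\<in>front_faces. dim F \<le> k \<longrightarrow> (a F, b F) = (1, real (dim F))) \<and>
     (\<forall>F\<in>front_faces. eventually_constant_at b F \<longrightarrow>
        (\<Sum>F' | F' \<in> front_faces \<and> F \<subseteq> F'. (- 1) ^ (dim F' - dim F) * a F') \<ge> 0)"

text \<open>The projection \<open>\<pi>\<^sup>F\<close> along \<open>F\<close>, with values in \<^term>\<open>compl_face F\<close>.\<close>

definition face_proj :: "(real^'r::finite) set \<Rightarrow> real^'r \<Rightarrow> real^'r" where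
  "face_proj F u = (\<chi> i. if i \<in> face_vertex F then 0 else u $ i)"

definition push_along :: "(real^'r::finite) set \<Rightarrow> (real^'r) measure \<Rightarrow> (real^'r) measure" where
  "push_along F c = distr c borel (face_proj F)"

text \<open>The marginal \<open>c\<^sub>F\<close>, as a measure on \<open>\<real>\<^sup>r\<close> concentrated on \<open>F\<close>.\<close>

definition face_marginal :: "(real^'r::finite) set \<Rightarrow> (real^'r) measure \<Rightarrow> (real^'r) measure" where
  "face_marginal F c = push_along (compl_face F) c"

text \<open>
  The uniform distribution on \<open>F \<cong> [0,1]\<^bsup>dim F\<^esup>\<close>: coordinates in \<open>F\<close> are independent and uniform,
  the others vanish. It is obtained from the uniform distribution on the cube by dropping
  coordinates.
\<close>

definition face_uniform :: "(real^'r::finite) set \<Rightarrow> (real^'r) measure" where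
  "face_uniform F = face_marginal F (uniform_measure lborel unit_cube)"

definition cube_prob :: "(real^'r::finite) measure \<Rightarrow> bool" where
  "cube_prob c \<longleftrightarrow> prob_space c \<and> sets c = sets borel \<and> emeasure c unit_cube = 1"

definition copula_of_order :: "nat \<Rightarrow> (real^'r::finite) measure \<Rightarrow> bool" where
  "copula_of_order k c \<longleftrightarrow>
     cube_prob c \<and> (\<forall>F\<in>front_faces. dim F = k \<longrightarrow> face_marginal F c = face_uniform F)"

text \<open>
  Under the identification \<open>F \<cong> [0,1]\<^bsup>dim F\<^esup>\<close> the set \<open>s [0,1]\<^bsup>dim F\<^esup>\<close> is the homothetic image
  \<open>s F\<close>. The limits are taken in the extended reals, as \<open>s\<close> tends to \<open>0\<close> from above.
\<close>

definition tail_liminf :: "(real^'r::finite) measure \<Rightarrow> (real^'r) set \<Rightarrow> real \<Rightarrow> ereal" where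
  "tail_liminf c F \<tau> =
     Liminf (at_right 0) (\<lambda>s. ereal (measure (face_marginal F c) ((\<lambda>u. s *\<^sub>R u) ` F) / s powr \<tau>))"

definition tdeg :: "(real^'r::finite) measure \<Rightarrow> (real^'r) set \<Rightarrow> ereal" where
  "tdeg c F = (INF \<tau> \<in> {\<tau>::real. tail_liminf c F \<tau> = \<infinity>}. ereal \<tau>)"

definition tcoef :: "(real^'r::finite) measure \<Rightarrow> (real^'r) set \<Rightarrow> ereal" where
  "tcoef c F = (if \<bar>tdeg c F\<bar> \<noteq> \<infinity> then tail_liminf c F (real_of_ereal (tdeg c F)) else 0)"

definition tchar :: "(real^'r::finite) measure \<Rightarrow> (real^'r) set \<Rightarrow> ereal \<times> ereal" where
  "tchar c F = (tcoef c F, tdeg c F)"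

definition vertex_box :: "real^'r \<Rightarrow> 'r::finite vertex \<Rightarrow> (real^'r) set" where
  "vertex_box u \<nu> = cbox (\<chi> i. if i \<in> \<nu> then u $ i else 0) (\<chi> i. if i \<in> \<nu> then 1 else u $ i)"

text \<open>
  The measure that is uniform with mass \<open>z \<nu>\<close> on each box, for \<open>u \<in> (0,1)\<^sup>r\<close> and \<open>z \<ge> 0\<close> (signed
  measures are not needed, as vertex copulas have nonnegative masses). Overlaps of the boxes are
  null sets.
\<close>

definition vertex_measure :: "real^'r \<Rightarrow> ('r::finite vertex \<Rightarrow> real) \<Rightarrow> (real^'r) measure" where
  "vertex_measure u z = density lborel
     (\<lambda>x. \<Sum>\<nu>\<in>UNIV. ennreal (z \<nu> / measure lborel (vertex_box u \<nu>)) * indicator (vertex_box u \<nu>) x)"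

definition vertex_copulas :: "nat \<Rightarrow> real^'r \<Rightarrow> ('r::finite vertex \<Rightarrow> real) set" where
  "vertex_copulas k u = {z. (\<forall>\<nu>. z \<nu> \<in> {0..1}) \<and> copula_of_order k (vertex_measure u z)}"

text \<open>
  \<open>z\<^bsup>(\<nu>)\<^esup>\<close>: the product of a measure on the face complementary to \<open>F\<close> and one on \<open>F\<close> is viewed as a
  measure on the whole cube by adding the two (complementary) groups of coordinates.
\<close>

definition uniformize ::
    "'r::finite vertex \<Rightarrow> (real^'r) measure \<Rightarrow> (real^'r) measure" where
  "uniformize \<nu> c =
     distr (push_along (front_face \<nu>) c \<Otimes>\<^sub>M face_uniform (front_face \<nu>)) borel (\<lambda>(x, y). x + y)"

text \<open>A grid is given by the set of its boxes.\<close>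

type_synonym 'r grid = "(real^'r) set set"

definition box_vertex :: "(real^'r::finite) set \<Rightarrow> 'r vertex" where
  "box_vertex J = {i. 0 \<notin> (\<lambda>x. x $ i) ` J}"

definition box_map :: "(real^'r::finite) set \<Rightarrow> real^'r \<Rightarrow> real^'r" where
  "box_map J x = (\<chi> i. interval_lowerbound J $ i +
     x $ i * (interval_upperbound J $ i - interval_lowerbound J $ i))"

definition tnest_measure ::
    "real^'r \<Rightarrow> ('r::finite vertex \<Rightarrow> real) \<Rightarrow> (real^'r) measure \<times> 'r grid \<Rightarrow> (real^'r) measure" where
  "tnest_measure u z = (\<lambda>(c, \<J>). measure_of UNIV (sets borel)
     (\<lambda>A. \<Sum>J\<in>\<J>. emeasure c J *
        emeasure (distr (uniformize (box_vertex J) (vertex_measure u z)) borel (box_map J)) A))"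

definition tnest_grid :: "real^'r \<Rightarrow> 'r::finite grid \<Rightarrow> 'r grid" where
  "tnest_grid u \<J> = {box_map J ` vertex_box u \<nu> | J \<nu>. J \<in> \<J>}"

definition tnest ::
    "real^'r \<Rightarrow> ('r::finite vertex \<Rightarrow> real) \<Rightarrow> (real^'r) measure \<times> 'r grid
       \<Rightarrow> (real^'r) measure \<times> 'r grid" where
  "tnest u z c\<J> = (tnest_measure u z c\<J>, tnest_grid u (snd c\<J>))"

text \<open>
  The sequences \<open>u\<close> and \<open>z\<close> are indexed by \<open>n \<ge> 1\<close> (index \<open>0\<close> is ignored), and
  \<open>tnest_seq u z n\<close> is \<open>c\<^bsup>n+1\<^esup>\<close> together with its grid.
\<close>

primrec tnest_seq ::
    "(nat \<Rightarrow> real^'r) \<Rightarrow> (nat \<Rightarrow> 'r::finite vertex \<Rightarrow> real) \<Rightarrow> nat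
       \<Rightarrow> (real^'r) measure \<times> 'r grid" where
  "tnest_seq u z 0 = (vertex_measure (u 1) (z 1), range (vertex_box (u 1)))"
| "tnest_seq u z (Suc n) = tnest (u (n + 2)) (z (n + 2)) (tnest_seq u z n)"

definition weak_limit :: "(nat \<Rightarrow> (real^'r::finite) measure) \<Rightarrow> (real^'r) measure \<Rightarrow> bool" where
  "weak_limit C c \<longleftrightarrow>
     (\<forall>f :: real^'r \<Rightarrow> real. continuous_on UNIV f \<longrightarrow> bounded (range f) \<longrightarrow>
        (\<lambda>n. integral\<^sup>L (C n) f) \<longlonglongrightarrow> integral\<^sup>L c f)"

definition is_tnest_limit ::
    "(nat \<Rightarrow> real^'r) \<Rightarrow> (nat \<Rightarrow> 'r::finite vertex \<Rightarrow> real) \<Rightarrow> (real^'r) measure \<Rightarrow> bool" where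
  "is_tnest_limit u z c \<longleftrightarrow> cube_prob c \<and> weak_limit (\<lambda>n. fst (tnest_seq u z n)) c"

lemma emeasure_tnest_measure:
  assumes "A \<in> sets borel"
  shows "emeasure (tnest_measure u z (c, \<J>)) A = (\<Sum>J\<in>\<J>. emeasure c J *
    emeasure (distr (uniformize (box_vertex J) (vertex_measure u z)) borel (box_map J)) A)"
proof (rule emeasure_measure_of)
  show "tnest_measure u z (c, \<J>) = measure_of UNIV (sets borel) (\<lambda>A. \<Sum>J\<in>\<J>. emeasure c J *
    emeasure (distr (uniformize (box_vertex J) (vertex_measure u z)) borel (box_map J)) A)"
    by (simp add: tnest_measure_def)
  show "countably_additive (sets (tnest_measure u z (c, \<J>))) (\<lambda>A. \<Sum>J\<in>\<J>. emeasure c J *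
    emeasure (distr (uniformize (box_vertex J) (vertex_measure u z)) borel (box_map J)) A)"
    (is "countably_additive _ (\<lambda>A. \<Sum>J\<in>\<J>. _ J * emeasure (?D J) A)")
  proof (rule countably_additiveI)
    fix B :: "nat \<Rightarrow> (real^'a) set"
    assume B: "range B \<subseteq> sets (tnest_measure u z (c, \<J>))" "disjoint_family B"
    have B': "range B \<subseteq> sets (?D J)" for J
      using B(1) by (auto simp: tnest_measure_def sets.sigma_sets_eq[of borel, simplified])
    have "(\<Sum>n. \<Sum>J\<in>\<J>. emeasure c J * emeasure (?D J) (B n))
        = (\<Sum>J\<in>\<J>. \<Sum>n. emeasure c J * emeasure (?D J) (B n))"
      by (rule suminf_sum) (rule summableI)
    also have "\<dots> = (\<Sum>J\<in>\<J>. emeasure c J * emeasure (?D J) (\<Union>n. B n))"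
      using suminf_emeasure[OF B' B(2)] by simp
    finally show "(\<Sum>n. \<Sum>J\<in>\<J>. emeasure c J * emeasure (?D J) (B n))
        = (\<Sum>J\<in>\<J>. emeasure c J * emeasure (?D J) (\<Union>n. B n))" .
  qed
qed (use assms in \<open>auto simp: tnest_measure_def positive_def sets.sigma_sets_eq[of borel, simplified]\<close>)

end

theory Submission
  imports Defs
begin

text \<open>
  On a grid copula, one step of tail nesting leaves the coordinates exceeding the corner size
  \<open>q = t\<^sup>n\<close> unchanged in law and replaces the remaining ones by \<open>q\<close> times those of an independent
  vertex copula \<open>z\<close>. Iterating this random map over independent vertex copulas realises all
  \<open>c\<^sup>n\<close> on one probability space, where they converge surely, and it gives, for \<open>t \<le> s \<le> 1\<close>,
  \<open>c\<^sup>\<infinity>\<^sub>F(t\<^sup>n s) = p\<^sub>1(F) \<cdots> p\<^sub>n(F) P\<^sub>F(s)\<close>, with \<open>p\<^sub>m(F)\<close> the mass that \<open>z\<^sub>m\<close> gives to the corner of size \<open>t\<close>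
  and \<open>P\<^sub>F\<close> the corner profile of \<open>z\<^sub>n\<^sub>+\<^sub>1\<close>. If \<open>p\<^sub>m(F) = t\<^bsup>b(F)\<^esup>\<close> for all large \<open>m\<close>, the
  tail degree is \<open>b(F)\<close>, and the tail coefficient is the accumulated constant times
  \<open>\<kappa>(F) = inf P\<^sub>F(s) / s\<^bsup>b(F)\<^esup>\<close>. The constant \<open>a(F) / \<kappa>(F)\<close> can be as large as a negative power of \<open>t\<close>,
  so it is spread evenly over the first \<open>N\<close> vertex copulas. Strict monotonicity of \<open>b\<close> makes \<open>p\<^sub>m\<close> drop
  so fast along inclusions, for small \<open>t\<close>, that its Moebius inverse is nonnegative.
\<close>

section \<open>Uniform distributions on boxes\<close>

text \<open>The obstacle is a circularity. The constant still to be corrected is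
  \<open>K = a / \<kappa>\<close>, and \<open>\<kappa>\<close> depends on the vertex copula of the
  late steps, hence on \<open>t\<close>; so \<open>t\<close> cannot be chosen small in terms of
  \<open>K\<close>. It is fixed first, from \<open>b\<close> and the dimension alone, with slack for
  correction factors in [1/2, 2]. Only then is \<open>N\<close> taken so large that every
  \<open>root N (K \<nu>)\<close>, which tends to 1, lies in that interval.

  The correction must also respect the order \<open>k\<close>. On faces of dimension at most
  \<open>k\<close> the late vertex copula has uniform marginals, so its profile is a pure power and
  \<open>\<kappa>\<close> is 1; as \<open>a\<close> is 1 there as well, nothing is corrected.

  The coefficient is governed by an infimum over [t,1] because the corner mass at level
  \<open>s\<close>, divided by \<open>s powr b\<close>, is for small \<open>s\<close> periodic in
  the logarithm of \<open>s\<close>, with period the logarithm of \<open>t\<close>. Its lower limit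
  at 0 is the infimum over one period.\<close>

lemma measure_eqI_box:
  fixes M N :: "'a::euclidean_space measure"
  assumes [simp]: "sets M = sets borel" "sets N = sets borel"
    and eq: "\<And>a b. emeasure M (box a b) = emeasure N (box a b)"
    and fin: "\<And>a b. emeasure M (box a b) \<noteq> \<infinity>"
  shows "M = N"
proof (rule measure_eqI_generator_eq)
  let ?E = "range (\<lambda>(a, b). box a b::'a set)"
  show "Int_stable ?E"
    by (auto simp: Int_stable_def box_Int_box)
  have "sets borel = sigma_sets UNIV ?E"
    unfolding borel_eq_box by (rule sets_measure_of) simp
  then show "?E \<subseteq> Pow UNIV" "sets M = sigma_sets UNIV ?E" "sets N = sigma_sets UNIV ?E"
    by (simp_all add: borel_eq_box)
  let ?A = "\<lambda>n::nat. box (- (real n *\<^sub>R One)) (real n *\<^sub>R One) :: 'a set"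
  show "range ?A \<subseteq> ?E" "(\<Union>i. ?A i) = UNIV"
    using UN_box_eq_UNIV[where ?'a='a] by auto
  show "emeasure M (?A i) \<noteq> \<infinity>" for i by (rule fin)
  show "emeasure M X = emeasure N X" if "X \<in> ?E" for X using that eq by auto
qed

lemma emeasure_lborel_cbox_cart:
  fixes l h :: "real^'r::finite"
  shows "emeasure lborel (cbox l h) = (\<Prod>i\<in>UNIV. ennreal (max 0 (h$i - l$i)))"
proof (cases "\<forall>i. l$i \<le> h$i")
  case True
  then have "cbox l h \<noteq> {}" by (simp add: interval_ne_empty_cart)
  then have "emeasure lborel (cbox l h) = ennreal (\<Prod>i\<in>UNIV. h$i - l$i)"
    using content_cbox_cart[of l h] emeasure_lborel_cbox_finite[of l h]
    by (subst emeasure_eq_ennreal_measure) auto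
  then show ?thesis using True by (simp add: prod_ennreal max_def)
next
  case False
  then obtain j where j: "h$j < l$j" by (auto simp: not_le)
  then have "cbox l h = {}" by (auto simp: interval_eq_empty_cart)
  moreover have "(\<Prod>i\<in>UNIV. ennreal (max 0 (h$i - l$i))) = 0"
    using j by (intro prod_zero bexI[of _ j]) auto
  ultimately show ?thesis by simp
qed

text \<open>The intersection of a closed and an open box lies between the open and the closed box
  with endpoints \<open>L\<close> and \<open>H\<close>, and these have equal volume; the cut-off at
  0 covers the empty case.\<close>

lemma emeasure_lborel_cbox_Int_box:
  fixes l h a b :: "real^'r::finite"
  shows "emeasure lborel (cbox l h \<inter> box a b)
    = (\<Prod>i\<in>UNIV. ennreal (max 0 (min (h$i) (b$i) - max (l$i) (a$i))))"
proof -
  define L H where "L = (\<chi> i. max (l$i) (a$i))" and "H = (\<chi> i. min (h$i) (b$i))"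
  have "emeasure lborel (box L H) \<le> emeasure lborel (cbox l h \<inter> box a b)"
    by (rule emeasure_mono) (auto simp: L_def H_def mem_box_cart less_imp_le)
  moreover have "emeasure lborel (cbox l h \<inter> box a b) \<le> emeasure lborel (cbox L H)"
    by (rule emeasure_mono) (auto simp: L_def H_def mem_box_cart less_imp_le)
  moreover have "emeasure lborel (box L H) = emeasure lborel (cbox L H)"
    by (simp add: emeasure_lborel_box_eq emeasure_lborel_cbox_eq)
  ultimately have "emeasure lborel (cbox l h \<inter> box a b) = emeasure lborel (cbox L H)"
    by simp
  then show ?thesis
    by (simp add: emeasure_lborel_cbox_cart L_def H_def)
qed

abbreviation cube_unif :: "(real^'r::finite) measure" where
  "cube_unif \<equiv> uniform_measure lborel unit_cube"

lemma emeasure_uniform_cbox_box: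
  fixes l h a b :: "real^'r::finite"
  assumes lh: "\<And>i. l$i < h$i"
  shows "emeasure (uniform_measure lborel (cbox l h)) (box a b)
    = (\<Prod>i\<in>UNIV. ennreal (max 0 (min (h$i) (b$i) - max (l$i) (a$i)) / (h$i - l$i)))"
proof -
  have pos: "0 < h$i - l$i" for i using lh[of i] by simp
  have "emeasure (uniform_measure lborel (cbox l h)) (box a b) =
     (\<Prod>i\<in>UNIV. ennreal (max 0 (min (h$i) (b$i) - max (l$i) (a$i)))) / (\<Prod>i\<in>UNIV. ennreal (max 0 (h$i - l$i)))"
    by (simp add: emeasure_lborel_cbox_Int_box emeasure_lborel_cbox_cart)
  also have "\<dots> = ennreal (\<Prod>i\<in>UNIV. max 0 (min (h$i) (b$i) - max (l$i) (a$i))) / ennreal (\<Prod>i\<in>UNIV. h$i - l$i)"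
    using pos by (subst (1 2) prod_ennreal) (auto simp: less_imp_le max_absorb2)
  also have "\<dots> = ennreal ((\<Prod>i\<in>UNIV. max 0 (min (h$i) (b$i) - max (l$i) (a$i))) / (\<Prod>i\<in>UNIV. h$i - l$i))"
    by (rule divide_ennreal) (use pos in \<open>auto intro!: prod_nonneg prod_pos\<close>)
  also have "\<dots> = (\<Prod>i\<in>UNIV. ennreal (max 0 (min (h$i) (b$i) - max (l$i) (a$i)) / (h$i - l$i)))"
    using pos by (subst prod_ennreal) (auto simp: prod_dividef less_imp_le)
  finally show ?thesis .
qed

lemma prob_space_uniform_cbox:
  fixes l h :: "real^'r::finite"
  assumes lh: "\<And>i. l$i < h$i"
  shows "prob_space (uniform_measure lborel (cbox l h))"
proof (rule prob_space_uniform_measure)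
  have "(\<Prod>i\<in>UNIV. h$i - l$i) > 0" using lh by (intro prod_pos) auto
  then show "emeasure lborel (cbox l h) \<noteq> 0"
    using lh by (auto simp: emeasure_lborel_cbox_cart prod_ennreal less_imp_le less_imp_neq[THEN not_sym])
  show "emeasure lborel (cbox l h) \<noteq> \<infinity>"
    by (simp add: emeasure_lborel_cbox_eq)
qed

lemma prob_space_cube_unif: "prob_space (cube_unif :: (real^'r::finite) measure)"
  unfolding unit_cube_def by (rule prob_space_uniform_cbox) simp

lemma sets_unit_cube [measurable]: "unit_cube \<in> sets borel"
  by (simp add: unit_cube_def)

lemma emeasure_cube_unif_box:
  "emeasure cube_unif (box a b) = (\<Prod>i\<in>UNIV. ennreal (max 0 (min 1 (b$i) - max 0 (a$i))))"
  unfolding unit_cube_def by (subst emeasure_uniform_cbox_box) auto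

text \<open>\<open>box_map\<close> with the endpoints as explicit arguments: grids are handled below
  as sets of endpoint pairs, and endpoints of subboxes are themselves images under such
  maps.\<close>

definition box_aff :: "real^'r \<Rightarrow> real^'r \<Rightarrow> real^'r \<Rightarrow> real^'r" where
  "box_aff l h x = (\<chi> i. l$i + x$i * (h$i - l$i))"

lemma measurable_vec_lambda [measurable (raw)]:
  fixes f :: "'r::finite \<Rightarrow> 'a \<Rightarrow> real"
  assumes "\<And>i. f i \<in> borel_measurable M"
  shows "(\<lambda>x. (\<chi> i. f i x)) \<in> borel_measurable M"
  using assms by (subst borel_measurable_euclidean_space)
    (auto simp: Basis_vec_def inner_axis)

lemma measurable_vec_nth [measurable (raw)]:
  fixes f :: "'a \<Rightarrow> real^'r::finite"
  assumes "f \<in> borel_measurable M"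
  shows "(\<lambda>x. f x $ i) \<in> borel_measurable M"
  by (rule measurable_compose[OF assms]) (intro borel_measurable_continuous_onI continuous_intros)

lemma measurable_box_aff [measurable]: "box_aff l h \<in> borel_measurable borel"
  unfolding box_aff_def by measurable

lemma distr_cube_unif_box_aff:
  fixes l h :: "real^'r::finite"
  assumes lh: "\<And>i. l$i < h$i"
  shows "distr cube_unif borel (box_aff l h) = uniform_measure lborel (cbox l h)"
proof (rule measure_eqI_box)
  interpret prob_space "cube_unif :: (real^'r) measure" by (rule prob_space_cube_unif)
  have m: "box_aff l h \<in> measurable cube_unif borel"
    by (simp add: measurable_def[of "uniform_measure _ _"] measurable_sets[OF measurable_box_aff, simplified])
  interpret D: prob_space "distr cube_unif borel (box_aff l h)"
    by (rule prob_space_distr[OF m])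
  show "emeasure (distr cube_unif borel (box_aff l h)) (box a b) \<noteq> \<infinity>" for a b
    by simp
  show "emeasure (distr cube_unif borel (box_aff l h)) (box a b) = emeasure (uniform_measure lborel (cbox l h)) (box a b)" for a b
  proof -
    have "box_aff l h -` box a b = box (\<chi> i. (a$i - l$i)/(h$i-l$i)) (\<chi> i. (b$i - l$i)/(h$i-l$i))"
      using lh by (auto simp: mem_box_cart box_aff_def field_simps)
    then have "emeasure (distr cube_unif borel (box_aff l h)) (box a b) =
      (\<Prod>i\<in>UNIV. ennreal (max 0 (min 1 ((b$i - l$i)/(h$i-l$i)) - max 0 ((a$i - l$i)/(h$i-l$i)))))"
      by (simp add: emeasure_distr[OF m] emeasure_cube_unif_box)
    also have "\<dots> = emeasure (uniform_measure lborel (cbox l h)) (box a b)"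
      unfolding emeasure_uniform_cbox_box[OF lh]
    proof (intro prod.cong refl arg_cong[where f=ennreal])
      fix i
      have p: "0 < h$i - l$i" using lh[of i] by simp
      have 1: "min 1 ((b$i - l$i)/(h$i-l$i)) = (min (h$i) (b$i) - l$i)/(h$i-l$i)"
        using p by (auto simp: min_def field_simps)
      have 2: "max 0 ((a$i - l$i)/(h$i-l$i)) = (max (l$i) (a$i) - l$i)/(h$i-l$i)"
        using p by (auto simp: max_def field_simps)
      show "max 0 (min 1 ((b$i - l$i)/(h$i-l$i)) - max 0 ((a$i - l$i)/(h$i-l$i)))
        = max 0 (min (h$i) (b$i) - max (l$i) (a$i)) / (h$i - l$i)"
        unfolding 1 2 diff_divide_distrib[symmetric] using p
        by (auto simp: max_def[of 0] field_simps)
    qed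
    finally show ?thesis .
  qed
qed auto

text \<open>Gluing along complementary sets of coordinates takes the place of adding vectors
  supported on complementary faces; \<open>uniformize_eq\<close> rewrites the product measure behind
  \<open>uniformize\<close> in this way.\<close>

definition vec_mix :: "'r set \<Rightarrow> (real^'r) \<times> (real^'r) \<Rightarrow> real^'r" where
  "vec_mix S = (\<lambda>(x, y). \<chi> i. if i \<in> S then x$i else y$i)"

lemma measurable_vec_mix [measurable]:
  "vec_mix S \<in> borel_measurable (borel \<Otimes>\<^sub>M (borel :: (real^'r::finite) measure))"
  unfolding vec_mix_def split_beta' by (rule measurable_vec_lambda) simp

lemma distr_cube_unif_vec_mix:
  "distr (cube_unif \<Otimes>\<^sub>M cube_unif) borel (vec_mix S) = (cube_unif :: (real^'r::finite) measure)"
proof (rule measure_eqI_box)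
  interpret U: prob_space "cube_unif :: (real^'r) measure" by (rule prob_space_cube_unif)
  interpret P: pair_prob_space "cube_unif :: (real^'r) measure" "cube_unif :: (real^'r) measure" ..
  have m: "vec_mix S \<in> measurable (cube_unif \<Otimes>\<^sub>M cube_unif) (borel :: (real^'r) measure)"
    by measurable
  interpret D: prob_space "distr (cube_unif \<Otimes>\<^sub>M cube_unif) borel (vec_mix S) :: (real^'r) measure"
    by (rule P.prob_space_distr[OF m])
  show "emeasure (distr (cube_unif \<Otimes>\<^sub>M cube_unif) borel (vec_mix S)) (box a b) \<noteq> \<infinity>" for a b :: "real^'r"
    by simp
  show "emeasure (distr (cube_unif \<Otimes>\<^sub>M cube_unif) borel (vec_mix S)) (box a b) = emeasure cube_unif (box a b)"
    for a b :: "real^'r"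
  proof -
    \<comment> \<open>The values -1 and 2 lie outside [0,1]: coordinates outside \<open>T\<close>
      are then unconstrained on the cube and contribute the factor 1.\<close>
    let ?a = "\<lambda>T. (\<chi> i. if i \<in> T then a$i else -1) :: real^'r"
    let ?b = "\<lambda>T. (\<chi> i. if i \<in> T then b$i else 2) :: real^'r"
    let ?g = "\<lambda>i. ennreal (max 0 (min 1 (b$i) - max 0 (a$i)))"
    have 1: "emeasure (cube_unif :: (real^'r) measure) {x. \<forall>i\<in>T. a$i < x$i \<and> x$i < b$i} = (\<Prod>i\<in>T. ?g i)" for T :: "'r set"
    proof -
      have "- 1 < x$i \<and> x$i < 2" if "x \<in> unit_cube" for x :: "real^'r" and i
        using that by (simp add: unit_cube_def mem_box_cart) (smt (verit))
      then have "unit_cube \<inter> {x. \<forall>i\<in>T. a$i < x$i \<and> x$i < b$i} = unit_cube \<inter> box (?a T) (?b T)"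
        by (auto simp: mem_box_cart split: if_splits)
      then have "emeasure (cube_unif :: (real^'r) measure) {x. \<forall>i\<in>T. a$i < x$i \<and> x$i < b$i} = emeasure cube_unif (box (?a T) (?b T))"
        by (subst (1 2) emeasure_uniform_measure) simp_all
      also have "\<dots> = (\<Prod>i\<in>UNIV. if i \<in> T then ?g i else 1)"
        by (auto simp: emeasure_cube_unif_box intro!: prod.cong)
      also have "\<dots> = (\<Prod>i\<in>T. ?g i)"
        by (simp add: prod.If_cases)
      finally show ?thesis .
    qed
    have "vec_mix S -` box a b = {x. \<forall>i\<in>S. a$i < x$i \<and> x$i < b$i} \<times> {x. \<forall>i\<in>-S. a$i < x$i \<and> x$i < b$i}"
      by (auto simp: vec_mix_def mem_box_cart split: if_splits)
    then have "emeasure (distr (cube_unif \<Otimes>\<^sub>M cube_unif) borel (vec_mix S)) (box a b) = 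
       emeasure (cube_unif \<Otimes>\<^sub>M cube_unif) ({x. \<forall>i\<in>S. a$i < x$i \<and> x$i < b$i} \<times> {x. \<forall>i\<in>-S. a$i < x$i \<and> x$i < b$i})"
      by (simp add: emeasure_distr[OF m] space_pair_measure)
    also have "\<dots> = (\<Prod>i\<in>S. ?g i) * (\<Prod>i\<in>-S. ?g i)"
      by (subst U.emeasure_pair_measure_Times) (auto simp: 1)
    also have "\<dots> = (\<Prod>i\<in>UNIV. ?g i)"
      by (subst prod.union_disjoint[symmetric]) auto
    finally show ?thesis by (simp add: emeasure_cube_unif_box)
  qed
qed auto

lemma AE_lborel_vec_nth_neq: "AE x in lborel. (x :: real^'r::finite) $ i \<noteq> c"
proof -
  have "axis i 1 \<noteq> (0::real^'r)" by (simp add: axis_eq_0_iff)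
  then have "negligible {x :: real^'r. axis i 1 \<bullet> x = c}"
    by (intro negligible_hyperplane) simp
  moreover have "{x :: real^'r. axis i 1 \<bullet> x = c} = {x. x $ i = c}"
    by (simp add: inner_axis')
  moreover have "{x :: real^'r. x $ i = c} \<in> sets borel" by simp
  ultimately have "{x :: real^'r. x $ i = c} \<in> null_sets lborel"
    by (simp add: negligible_iff_null_sets null_sets_completion_iff)
  then show ?thesis by (rule AE_I') auto
qed

lemma AE_cube_unif: "AE x in (cube_unif :: (real^'r::finite) measure). x \<in> unit_cube \<and> (\<forall>i. x $ i > 0)"
proof (rule AE_uniform_measureI)
  have "AE x in lborel. \<forall>i. (x :: real^'r) $ i \<noteq> 0"
    by (subst AE_all_countable) (simp add: AE_lborel_vec_nth_neq)
  then show "AE x in lborel. x \<in> unit_cube \<longrightarrow> x \<in> unit_cube \<and> (\<forall>i. (x :: real^'r) $ i > 0)"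
    by eventually_elim (auto simp: unit_cube_def mem_box_cart less_le)
qed simp

section \<open>Product measures: almost sure properties and mixtures\<close>

lemma AE_pair_fst:
  assumes "prob_space M" "prob_space N" "AE x in M. P x"
  shows "AE z in M \<Otimes>\<^sub>M N. P (fst z)"
proof -
  interpret N: prob_space N by fact
  have "distr (M \<Otimes>\<^sub>M N) M fst = M"
    by (simp add: N.distr_pair_fst N.emeasure_space_1 scale_measure_1)
  then have "AE x in distr (M \<Otimes>\<^sub>M N) M fst. P x"
    using assms(3) by (rule ssubst)
  then show ?thesis
    by (rule AE_distrD[rotated]) simp
qed

lemma AE_pair_snd:
  assumes "prob_space M" "prob_space N" "AE x in N. P x"
  shows "AE z in M \<Otimes>\<^sub>M N. P (snd z)"
proof -
  interpret M: prob_space M by fact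
  interpret N: prob_space N by fact
  interpret pair_prob_space M N ..
  interpret Q: pair_prob_space N M ..
  have "distr (M \<Otimes>\<^sub>M N) N snd = N"
  proof -
    have "distr (M \<Otimes>\<^sub>M N) N snd = distr (N \<Otimes>\<^sub>M M) N (snd \<circ> (\<lambda>(x, y). (y, x)))"
      by (subst distr_pair_swap) (simp add: distr_distr)
    also have "snd \<circ> (\<lambda>(x, y). (y, x)) = (fst :: 'b \<times> 'a \<Rightarrow> 'b)" by auto
    finally show ?thesis by (simp add: M.distr_pair_fst M.emeasure_space_1 scale_measure_1)
  qed
  then have "AE x in distr (M \<Otimes>\<^sub>M N) N snd. P x"
    using assms(3) by (rule ssubst)
  then show ?thesis
    by (rule AE_distrD[rotated]) simp
qed

text \<open>A product measure is linear in each factor, by integrating sections. Grid copulas and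
  vertex measures are mixtures of uniform distributions on boxes, so this reduces their product to
  pairs of boxes.\<close>

lemma emeasure_pair_mixture_fst:
  fixes N :: "'b measure" and M :: "'i \<Rightarrow> 'a measure"
  assumes "prob_space N" "prob_space c" "finite I" "\<And>i. i \<in> I \<Longrightarrow> prob_space (M i)"
    and s: "\<And>i. i \<in> I \<Longrightarrow> sets (M i) = sets c"
    and mix: "\<And>A. A \<in> sets c \<Longrightarrow> emeasure c A = (\<Sum>i\<in>I. w i * emeasure (M i) A)"
    and Q: "Q \<in> sets (c \<Otimes>\<^sub>M N)"
  shows "emeasure (c \<Otimes>\<^sub>M N) Q = (\<Sum>i\<in>I. w i * emeasure (M i \<Otimes>\<^sub>M N) Q)"
proof -
  interpret N: prob_space N by fact
  interpret c: prob_space c by fact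
  interpret cN: pair_prob_space c N ..
  have QM: "Q \<in> sets (M i \<Otimes>\<^sub>M N)" if "i \<in> I" for i
    using Q sets_pair_measure_cong[OF s[OF that] refl, of N] by simp
  have "emeasure (c \<Otimes>\<^sub>M N) Q = (\<integral>\<^sup>+y. emeasure c ((\<lambda>x. (x, y)) -` Q) \<partial>N)"
    by (rule cN.emeasure_pair_measure_alt2[OF Q])
  also have "\<dots> = (\<integral>\<^sup>+y. (\<Sum>i\<in>I. w i * emeasure (M i) ((\<lambda>x. (x, y)) -` Q)) \<partial>N)"
    using sets_Pair2[OF Q] by (intro nn_integral_cong mix)
  also have "\<dots> = (\<Sum>i\<in>I. \<integral>\<^sup>+y. w i * emeasure (M i) ((\<lambda>x. (x, y)) -` Q) \<partial>N)"
  proof (rule nn_integral_sum)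
    fix i assume i: "i \<in> I"
    interpret Mi: prob_space "M i" using assms(4) i by simp
    interpret pair_prob_space "M i" N ..
    show "(\<lambda>y. w i * emeasure (M i) ((\<lambda>x. (x, y)) -` Q)) \<in> borel_measurable N"
      by (intro borel_measurable_times_ennreal measurable_emeasure_Pair2 borel_measurable_const QM i)
  qed
  also have "\<dots> = (\<Sum>i\<in>I. w i * emeasure (M i \<Otimes>\<^sub>M N) Q)"
  proof (rule sum.cong[OF refl])
    fix i assume i: "i \<in> I"
    interpret Mi: prob_space "M i" using assms(4) i by simp
    interpret pair_prob_space "M i" N ..
    show "(\<integral>\<^sup>+y. w i * emeasure (M i) ((\<lambda>x. (x, y)) -` Q) \<partial>N) = w i * emeasure (M i \<Otimes>\<^sub>M N) Q"
      by (subst nn_integral_cmult)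
        (simp_all add: measurable_emeasure_Pair2 emeasure_pair_measure_alt2 QM[OF i])
  qed
  finally show ?thesis .
qed

lemma emeasure_pair_mixture_snd:
  fixes c :: "'b measure" and M :: "'i \<Rightarrow> 'a measure"
  assumes "prob_space c" "prob_space N" "finite I" "\<And>i. i \<in> I \<Longrightarrow> prob_space (M i)"
    and s: "\<And>i. i \<in> I \<Longrightarrow> sets (M i) = sets N"
    and mix: "\<And>A. A \<in> sets N \<Longrightarrow> emeasure N A = (\<Sum>i\<in>I. w i * emeasure (M i) A)"
    and Q: "Q \<in> sets (c \<Otimes>\<^sub>M N)"
  shows "emeasure (c \<Otimes>\<^sub>M N) Q = (\<Sum>i\<in>I. w i * emeasure (c \<Otimes>\<^sub>M M i) Q)"
proof -
  have sw: "emeasure (c \<Otimes>\<^sub>M K) Q = emeasure (K \<Otimes>\<^sub>M c) ((\<lambda>(x, y). (y, x)) -` Q \<inter> space (K \<Otimes>\<^sub>M c))"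
    if "prob_space K" "sets K = sets N" for K
  proof -
    interpret c: prob_space c by fact
    interpret K: prob_space K by fact
    interpret pair_prob_space c K ..
    have "Q \<in> sets (c \<Otimes>\<^sub>M K)" using Q sets_pair_measure_cong[OF refl that(2), of c] by simp
    then show ?thesis
      by (subst distr_pair_swap) (simp add: emeasure_distr)
  qed
  have sp: "space (M i \<Otimes>\<^sub>M c) = space (N \<Otimes>\<^sub>M c)" if "i \<in> I" for i
    using sets_eq_imp_space_eq[OF s[OF that]] by (simp add: space_pair_measure)
  have m: "(\<lambda>(x, y). (y, x)) -` Q \<inter> space (N \<Otimes>\<^sub>M c) \<in> sets (N \<Otimes>\<^sub>M c)"
    using measurable_sets[OF measurable_pair_swap' Q] .
  show ?thesis
    using emeasure_pair_mixture_fst[OF assms(1-4) s mix m]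
    by (simp add: sw assms(2,4) s sp)
qed

text \<open>One nesting step as a map of a point \<open>x\<close> of the old copula and an
  independent point \<open>v\<close> of the next vertex copula. Clipping \<open>v\<close> to [0,1]
  changes nothing almost surely, but lets bounds on the iterates hold at every sample point. Ties
  \<open>x$i = q\<close> count as corner points, in accordance with the closed corners used
  below.\<close>

definition tail_step :: "real \<Rightarrow> (real^'r) \<times> (real^'r) \<Rightarrow> real^'r" where
  "tail_step q = (\<lambda>(x, v). \<chi> i. if x$i > q then x$i else q * max 0 (min 1 (v$i)))"

lemma measurable_tail_step [measurable]:
  "tail_step q \<in> borel_measurable (borel \<Otimes>\<^sub>M (borel :: (real^'r::finite) measure))"
  unfolding tail_step_def split_beta' by (rule measurable_vec_lambda) measurable

lemma face_proj_front_face [simp]: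
  "face_proj (front_face \<nu>) u = (\<chi> i. if i \<in> \<nu> then 0 else u $ i)"
  by (simp add: face_proj_def)

lemma compl_front_face [simp]: "compl_face (front_face \<nu>) = front_face (- \<nu>)"
  by (simp add: compl_face_def)

lemma measurable_face_proj [measurable]: "face_proj F \<in> borel_measurable borel"
  unfolding face_proj_def by (rule measurable_vec_lambda) simp

text \<open>The two projections have complementary supports, so adding them selects each coordinate
  from one of the two points.\<close>

lemma uniformize_eq:
  fixes V :: "(real^'r::finite) measure"
  assumes V: "prob_space V" and sV: "sets V = sets borel"
  shows "uniformize \<nu> V = distr (cube_unif \<Otimes>\<^sub>M V) borel (vec_mix \<nu>)"
proof -
  interpret U: prob_space "cube_unif :: (real^'r) measure" by (rule prob_space_cube_unif)
  interpret V: prob_space V by fact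
  interpret VU: pair_prob_space V "cube_unif :: (real^'r) measure" ..
  note [measurable_cong] = sV
  let ?f = "face_proj (front_face \<nu>) :: real^'r \<Rightarrow> _" and ?g = "face_proj (front_face (- \<nu>)) :: real^'r \<Rightarrow> _"
  have p: "prob_space (distr cube_unif borel ?g)"
    by (rule U.prob_space_distr) measurable
  have plus: "(\<lambda>(x, y). x + y) \<in> borel_measurable (borel \<Otimes>\<^sub>M (borel :: (real^'r) measure))"
    unfolding split_beta' by measurable
  have "uniformize \<nu> V = distr (distr V borel ?f \<Otimes>\<^sub>M distr cube_unif borel ?g) borel (\<lambda>(x, y). x + y)"
    by (simp add: uniformize_def push_along_def face_uniform_def face_marginal_def)
  also have "\<dots> = distr (distr (V \<Otimes>\<^sub>M cube_unif) (borel \<Otimes>\<^sub>M borel) (\<lambda>(x, y). (?f x, ?g y))) borel (\<lambda>(x, y). x + y)"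
    by (subst pair_measure_distr) (auto intro: prob_space_imp_sigma_finite p)
  also have "\<dots> = distr (V \<Otimes>\<^sub>M cube_unif) borel ((\<lambda>(x, y). x + y) \<circ> (\<lambda>(x, y). (?f x, ?g y)))"
    by (rule distr_distr) (use plus in \<open>auto\<close>)
  also have "(\<lambda>(x, y). x + y) \<circ> (\<lambda>(x, y). (?f x, ?g y)) = (\<lambda>(v, x). vec_mix \<nu> (x, v))"
    by (auto simp: fun_eq_iff vec_mix_def vec_eq_iff)
  also have "distr (V \<Otimes>\<^sub>M cube_unif) borel (\<lambda>(v, x). vec_mix \<nu> (x, v))
     = distr (cube_unif \<Otimes>\<^sub>M V) borel (vec_mix \<nu>)"
  proof -
    interpret UV: pair_prob_space "cube_unif :: (real^'r) measure" V ..
    have "vec_mix \<nu> \<circ> (\<lambda>(x, y). (y, x)) = (\<lambda>(v, x :: real^'r). vec_mix \<nu> (x, v))" by auto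
    then show ?thesis
      by (subst UV.distr_pair_swap) (simp add: distr_distr)
  qed
  finally show ?thesis .
qed

section \<open>Grids adapted to the corner cell\<close>

lemma box_map_cbox:
  fixes l h :: "real^'r::finite"
  assumes "\<And>i. l$i \<le> h$i"
  shows "box_map (cbox l h) = box_aff l h"
proof -
  have "\<forall>b\<in>Basis. l \<bullet> b \<le> h \<bullet> b"
    using assms by (auto simp: Basis_vec_def inner_axis)
  then show ?thesis
    by (simp add: box_map_def box_aff_def fun_eq_iff)
qed

lemma box_vertex_cbox:
  fixes l h :: "real^'r::finite"
  assumes "\<And>i. l$i \<le> h$i" and "\<And>i. 0 \<le> h$i"
  shows "box_vertex (cbox l h) = {i. 0 < l$i}"
proof -
  have "0 \<in> (\<lambda>x. x $ i) ` cbox l h \<longleftrightarrow> l$i \<le> 0" for i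
  proof
    assume "l$i \<le> 0"
    then have "(\<chi> j. if j = i then 0 else l$j) \<in> cbox l h"
      using assms by (auto simp: mem_box_cart)
    then show "0 \<in> (\<lambda>x. x $ i) ` cbox l h" by (rule rev_image_eqI) simp
  qed (auto simp: mem_box_cart, metis)
  then show ?thesis by (auto simp: box_vertex_def not_le)
qed

definition vlo :: "real \<Rightarrow> 'r set \<Rightarrow> real^'r" where "vlo t \<eta> = (\<chi> i. if i \<in> \<eta> then t else 0)"
definition vhi :: "real \<Rightarrow> 'r set \<Rightarrow> real^'r" where "vhi t \<eta> = (\<chi> i. if i \<in> \<eta> then 1 else t)"

lemma vertex_box_eq: "vertex_box (vec t) \<eta> = cbox (vlo t \<eta>) (vhi t \<eta>)"
  by (simp add: vertex_box_def vlo_def vhi_def cong: if_cong)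

lemma vlo_less_vhi: "0 < t \<Longrightarrow> t < 1 \<Longrightarrow> vlo t \<eta> $ i < vhi t \<eta> $ i"
  by (simp add: vlo_def vhi_def)

lemma vertex_box_subset: "0 < t \<Longrightarrow> t < 1 \<Longrightarrow> vertex_box (vec t) \<eta> \<subseteq> unit_cube"
  unfolding vertex_box_eq unit_cube_def by (rule subset_interval_imp_cart(1)) (simp add: vlo_def vhi_def)

lemma box_aff_image_cbox:
  fixes l h :: "real^'r::finite"
  assumes lh: "\<And>i. l$i < h$i"
  shows "box_aff l h ` cbox a b = cbox (box_aff l h a) (box_aff l h b)"
proof (intro equalityI subsetI)
  fix y assume y: "y \<in> cbox (box_aff l h a) (box_aff l h b)"
  have "y = box_aff l h (\<chi> i. (y$i - l$i)/(h$i-l$i))"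
    using lh by (simp add: box_aff_def vec_eq_iff less_imp_neq[THEN not_sym])
  moreover have "(\<chi> i. (y$i - l$i)/(h$i-l$i)) \<in> cbox a b"
    using y lh by (simp add: mem_box_cart box_aff_def field_simps)
  ultimately show "y \<in> box_aff l h ` cbox a b" by blast
next
  fix y assume "y \<in> box_aff l h ` cbox a b"
  then show "y \<in> cbox (box_aff l h a) (box_aff l h b)"
    using lh by (auto simp: box_aff_def mem_box_cart less_imp_le intro!: mult_right_mono)
qed

text \<open>Invariant of the grids that occur. In each coordinate a box has the corner interval
  [0,q] or starts at \<open>q\<close> or later, so comparing a coordinate with \<open>q\<close>
  tells whether its box touches 0 there. The clause on two boxes is what remains of the product
  structure: in each coordinate their intervals are equal or have no common interior point.\<close>

definition tail_pairs :: "real \<Rightarrow> ((real^'r) \<times> (real^'r)) set \<Rightarrow> bool" where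
  "tail_pairs q P \<longleftrightarrow> finite P \<and> 0 < q \<and>
     (\<forall>(l, h)\<in>P. \<forall>i. 0 \<le> l$i \<and> l$i < h$i \<and> h$i \<le> 1 \<and> (l$i = 0 \<and> h$i = q \<or> q \<le> l$i)) \<and>
     (\<forall>(l, h)\<in>P. \<forall>(l', h')\<in>P. \<forall>i. l$i = l'$i \<and> h$i = h'$i \<or> h$i \<le> l'$i \<or> h'$i \<le> l$i) \<and>
     (\<forall>x\<in>unit_cube. \<exists>(l, h)\<in>P. x \<in> cbox l h)"

definition boxes :: "((real^'r) \<times> (real^'r)) set \<Rightarrow> 'r::finite grid" where
  "boxes P = (\<lambda>(l, h). cbox l h) ` P"

definition split_pairs :: "real \<Rightarrow> ((real^'r) \<times> (real^'r)) set \<Rightarrow> ((real^'r) \<times> (real^'r::finite)) set" where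
  "split_pairs t P = (\<lambda>((l, h), \<eta>). (box_aff l h (vlo t \<eta>), box_aff l h (vhi t \<eta>))) ` (P \<times> UNIV)"

lemma tail_pairsD:
  assumes "tail_pairs q P" "(l, h) \<in> P"
  shows "0 \<le> l$i" "l$i < h$i" "h$i \<le> 1" "l$i = 0 \<and> h$i = q \<or> q \<le> l$i"
proof -
  have "\<forall>i. 0 \<le> l$i \<and> l$i < h$i \<and> h$i \<le> 1 \<and> (l$i = 0 \<and> h$i = q \<or> q \<le> l$i)"
    using assms unfolding tail_pairs_def by blast
  then show "0 \<le> l$i" "l$i < h$i" "h$i \<le> 1" "l$i = 0 \<and> h$i = q \<or> q \<le> l$i" by blast+
qed

lemma tail_pairs_cases:
  assumes "tail_pairs q P" "(l, h) \<in> P" "(l', h') \<in> P"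
  shows "l$i = l'$i \<and> h$i = h'$i \<or> h$i \<le> l'$i \<or> h'$i \<le> l$i"
  using assms unfolding tail_pairs_def by blast

lemma split_pairsI:
  "(l, h) \<in> P \<Longrightarrow> (box_aff l h (vlo t \<eta>), box_aff l h (vhi t \<eta>)) \<in> split_pairs t P"
  unfolding split_pairs_def by (rule image_eqI[of _ _ "((l, h), \<eta>)"]) auto

lemma split_pairsE:
  assumes "(l', h') \<in> split_pairs t P"
  obtains l h \<eta> where "(l, h) \<in> P" "l' = box_aff l h (vlo t \<eta>)" "h' = box_aff l h (vhi t \<eta>)"
  using assms by (auto simp: split_pairs_def)

lemma tnest_grid_boxes:
  fixes P :: "((real^'r::finite) \<times> (real^'r)) set"
  assumes P: "tail_pairs q P"
  shows "tnest_grid (vec t) (boxes P) = boxes (split_pairs t P)"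
proof -
  have 1: "box_map (cbox l h) ` vertex_box (vec t) \<eta> = cbox (box_aff l h (vlo t \<eta>)) (box_aff l h (vhi t \<eta>))"
    if "(l, h) \<in> P" for l h :: "real^'r" and \<eta>
    using tail_pairsD[OF P that] by (simp add: box_map_cbox vertex_box_eq box_aff_image_cbox less_imp_le)
  show ?thesis
  proof (intro equalityI subsetI)
    fix K assume "K \<in> tnest_grid (vec t) (boxes P)"
    then obtain J \<eta> where K: "K = box_map J ` vertex_box (vec t) \<eta>" and J: "J \<in> boxes P"
      unfolding tnest_grid_def by blast
    from J obtain l h where lh: "(l, h) \<in> P" and J': "J = cbox l h" unfolding boxes_def by auto
    show "K \<in> boxes (split_pairs t P)"
      unfolding K J' 1[OF lh] boxes_def using split_pairsI[OF lh] by (rule rev_image_eqI) simp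
  next
    fix K assume "K \<in> boxes (split_pairs t P)"
    then obtain l' h' where K: "K = cbox l' h'" and "(l', h') \<in> split_pairs t P"
      unfolding boxes_def by auto
    then obtain l h \<eta> where lh: "(l, h) \<in> P" and "l' = box_aff l h (vlo t \<eta>)" "h' = box_aff l h (vhi t \<eta>)"
      by (elim split_pairsE)
    then have "K = box_map (cbox l h) ` vertex_box (vec t) \<eta>" using 1[OF lh] K by simp
    moreover have "cbox l h \<in> boxes P"
      unfolding boxes_def using lh by (rule rev_image_eqI) simp
    ultimately show "K \<in> tnest_grid (vec t) (boxes P)"
      unfolding tnest_grid_def by blast
  qed
qed

lemma box_aff_vlo_nth: "box_aff l h (vlo t \<eta>) $ i = (if i \<in> \<eta> then l$i + t * (h$i - l$i) else l$i)"
  and box_aff_vhi_nth: "box_aff l h (vhi t \<eta>) $ i = (if i \<in> \<eta> then h$i else l$i + t * (h$i - l$i))"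
  by (auto simp: box_aff_def vlo_def vhi_def)

lemma split_point:
  fixes l h t :: real
  assumes "l < h" "0 < t" "t < 1"
  shows "l < l + t * (h - l)" "l + t * (h - l) < h"
proof -
  show "l < l + t * (h - l)" using assms by simp
  have "t * (h - l) < 1 * (h - l)" using assms by (intro mult_strict_right_mono) auto
  then show "l + t * (h - l) < h" by simp
qed

text \<open>The cut at \<open>l + t * (h - l)\<close> turns the corner interval [0,q] into [0,tq]
  and [tq,q], and intervals starting at \<open>q\<close> or later stay away from 0. Equal intervals
  receive equal cuts, which preserves the dichotomy between boxes.\<close>

lemma tail_pairs_split:
  fixes P :: "((real^'r::finite) \<times> (real^'r)) set"
  assumes P: "tail_pairs q P" and t: "0 < t" "t < 1"
  shows "tail_pairs (t * q) (split_pairs t P)"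
proof -
  have q: "0 < q" "t * q < q" using P t by (auto simp: tail_pairs_def)
  note sp = split_point[OF _ t]
  have 1: "finite (split_pairs t P)" "0 < t * q"
    using P t by (auto simp: tail_pairs_def split_pairs_def)
  have 2: "0 \<le> l'$i \<and> l'$i < h'$i \<and> h'$i \<le> 1 \<and> (l'$i = 0 \<and> h'$i = t * q \<or> t * q \<le> l'$i)"
    if "(l', h') \<in> split_pairs t P" for l' h' i
  proof -
    from that obtain l h \<eta> where lh: "(l, h) \<in> P" and l': "l' = box_aff l h (vlo t \<eta>)" "h' = box_aff l h (vhi t \<eta>)"
      by (auto simp: split_pairs_def)
    note D = tail_pairsD[OF P lh, of i]
    define p where "p = l$i + t * (h$i - l$i)"
    have p: "l$i < p" "p < h$i" "l$i = 0 \<Longrightarrow> h$i = q \<Longrightarrow> p = t * q"       using sp[OF D(2)] by (auto simp: p_def)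
    moreover have "t * q \<le> l$i" if "q \<le> l$i" using q that by linarith
    ultimately show ?thesis unfolding l' box_aff_vlo_nth box_aff_vhi_nth p_def[symmetric]
      using D by (cases "i \<in> \<eta>") auto
  qed
  have 3: "l$i = l'$i \<and> h$i = h'$i \<or> h$i \<le> l'$i \<or> h'$i \<le> l$i"
    if "(l, h) \<in> split_pairs t P" "(l', h') \<in> split_pairs t P" for l h l' h' i
  proof -
    from that obtain a b \<eta> where lh: "(a, b) \<in> P" and l: "l = box_aff a b (vlo t \<eta>)" "h = box_aff a b (vhi t \<eta>)"
      by (auto simp: split_pairs_def)
    from that obtain a' b' \<eta>' where lh': "(a', b') \<in> P" and l': "l' = box_aff a' b' (vlo t \<eta>')" "h' = box_aff a' b' (vhi t \<eta>')"
      by (auto simp: split_pairs_def)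
    note D = tail_pairsD[OF P lh, of i] and D' = tail_pairsD[OF P lh', of i]
    show ?thesis unfolding l l' box_aff_vlo_nth box_aff_vhi_nth
      using tail_pairs_cases[OF P lh lh', of i] sp[OF D(2)] sp[OF D'(2)]
      by (cases "i \<in> \<eta>"; cases "i \<in> \<eta>'") auto
  qed
  have 4: "\<exists>(l, h)\<in>split_pairs t P. x \<in> cbox l h" if x: "x \<in> unit_cube" for x
  proof -
    from P x obtain a b where ab: "(a, b) \<in> P" and xc: "x \<in> cbox a b"
      unfolding tail_pairs_def by blast
    \<comment> \<open>The coordinates in which \<open>x\<close> has reached the cut name a subbox
      containing it.\<close>
    let ?\<eta> = "{i. a$i + t * (b$i - a$i) \<le> x$i}"
    have "x \<in> cbox (box_aff a b (vlo t ?\<eta>)) (box_aff a b (vhi t ?\<eta>))"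
      using xc by (auto simp: mem_box_cart box_aff_vlo_nth box_aff_vhi_nth)
    moreover have "(box_aff a b (vlo t ?\<eta>), box_aff a b (vhi t ?\<eta>)) \<in> split_pairs t P"
      unfolding split_pairs_def using ab by (intro image_eqI[of _ _ "((a, b), ?\<eta>)"]) auto
    ultimately show ?thesis by blast
  qed
  show ?thesis unfolding tail_pairs_def
  proof (intro conjI ballI)
    show "case a of (l, h) \<Rightarrow> \<forall>i. 0 \<le> l$i \<and> l$i < h$i \<and> h$i \<le> 1 \<and> (l$i = 0 \<and> h$i = t * q \<or> t * q \<le> l$i)"
      if "a \<in> split_pairs t P" for a
      using 2 that by (cases a) simp
    show "case a of (l, h) \<Rightarrow> \<forall>(l', h')\<in>split_pairs t P. \<forall>i. l$i = l'$i \<and> h$i = h'$i \<or> h$i \<le> l'$i \<or> h'$i \<le> l$i"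
      if "a \<in> split_pairs t P" for a
      using 3 that by (cases a) blast
  qed (use 1 4 in auto)
qed

section \<open>Vertex measures as mixtures of uniform distributions\<close>

lemma vertex_box_borel [measurable]: "vertex_box u \<eta> \<in> sets borel"
  by (simp add: vertex_box_def)

lemma emeasure_vertex_measure:
  fixes z :: "'r::finite vertex \<Rightarrow> real"
  assumes t: "0 < t" "t < 1" and z: "\<And>\<eta>. 0 \<le> z \<eta>" and A: "A \<in> sets borel"
  shows "emeasure (vertex_measure (vec t) z) A =
    (\<Sum>\<eta>\<in>UNIV. ennreal (z \<eta>) * emeasure (uniform_measure lborel (vertex_box (vec t) \<eta>)) A)"
proof -
  have [measurable]: "vertex_box (vec t) \<eta> \<in> sets borel" for \<eta> :: "'r vertex"
    by (simp add: vertex_box_def)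
  have vol: "emeasure lborel (vertex_box (vec t) \<eta>) = ennreal (measure lborel (vertex_box (vec t) \<eta>))"
     "0 < measure lborel (vertex_box (vec t) \<eta>)" for \<eta> :: "'r vertex"
  proof -
    have "emeasure lborel (vertex_box (vec t) \<eta>) = ennreal (\<Prod>i\<in>UNIV. vhi t \<eta> $ i - vlo t \<eta> $ i)"
      using vlo_less_vhi[OF t]
      by (simp add: vertex_box_eq emeasure_lborel_cbox_cart less_imp_le)
        (subst prod_ennreal; simp add: vlo_less_vhi[OF t] less_imp_le)
    moreover have "(\<Prod>i\<in>UNIV. vhi t \<eta> $ i - vlo t \<eta> $ i) > 0"
      using vlo_less_vhi[OF t] by (intro prod_pos) auto
    ultimately show "emeasure lborel (vertex_box (vec t) \<eta>) = ennreal (measure lborel (vertex_box (vec t) \<eta>))"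
     "0 < measure lborel (vertex_box (vec t) \<eta>)"
      by (simp_all add: measure_def less_imp_le)
  qed
  have "emeasure (vertex_measure (vec t) z) A = (\<integral>\<^sup>+x. (\<Sum>\<eta>\<in>UNIV. ennreal (z \<eta> / measure lborel (vertex_box (vec t) \<eta>)) *
      indicator (vertex_box (vec t) \<eta>) x) * indicator A x \<partial>lborel)"
    unfolding vertex_measure_def by (rule emeasure_density) (use A in \<open>measurable\<close>)
  also have "\<dots> = (\<integral>\<^sup>+x. (\<Sum>\<eta>\<in>UNIV. ennreal (z \<eta> / measure lborel (vertex_box (vec t) \<eta>)) *
      indicator (vertex_box (vec t) \<eta> \<inter> A) x) \<partial>lborel)"
    by (intro nn_integral_cong) (auto simp: sum_distrib_right indicator_def intro!: sum.cong)
  also have "\<dots> = (\<Sum>\<eta>\<in>UNIV. ennreal (z \<eta> / measure lborel (vertex_box (vec t) \<eta>)) *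
      emeasure lborel (vertex_box (vec t) \<eta> \<inter> A))"
    using A by (subst nn_integral_sum) (simp_all add: nn_integral_cmult)
  also have "\<dots> = (\<Sum>\<eta>\<in>UNIV. ennreal (z \<eta>) * emeasure (uniform_measure lborel (vertex_box (vec t) \<eta>)) A)"
    using A z vol by (simp add: divide_ennreal_def inverse_ennreal ennreal_mult' divide_inverse mult_ac)
  finally show ?thesis .
qed

lemma sets_vertex_measure [simp, measurable_cong]: "sets (vertex_measure u z) = sets borel"
  by (simp add: vertex_measure_def)

lemma prob_space_uniform_vertex_box:
  "0 < t \<Longrightarrow> t < 1 \<Longrightarrow> prob_space (uniform_measure lborel (vertex_box (vec t) \<eta>))"
  unfolding vertex_box_eq by (rule prob_space_uniform_cbox) (rule vlo_less_vhi)

lemma cube_prob_vertex_measure: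
  fixes z :: "'r::finite vertex \<Rightarrow> real"
  assumes t: "0 < t" "t < 1" and z: "\<And>\<eta>. 0 \<le> z \<eta>" and sum: "(\<Sum>\<eta>\<in>UNIV. z \<eta>) = 1"
  shows "cube_prob (vertex_measure (vec t) z)"
proof -
  have *: "emeasure (vertex_measure (vec t) z) A = 1" if A: "A \<in> sets borel" "unit_cube \<subseteq> A" for A
  proof -
    have "emeasure (uniform_measure lborel (vertex_box (vec t) \<eta>)) A = 1" for \<eta> :: "'r vertex"
    proof -
      interpret prob_space "uniform_measure lborel (vertex_box (vec t) \<eta>)"
        using t by (rule prob_space_uniform_vertex_box)
      have "emeasure (uniform_measure lborel (vertex_box (vec t) \<eta>)) A = emeasure (uniform_measure lborel (vertex_box (vec t) \<eta>)) UNIV"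
        using A vertex_box_subset[OF t, of \<eta>] by (simp add: Int_absorb2)
      then show ?thesis using emeasure_space_1 by simp
    qed
    then have "emeasure (vertex_measure (vec t) z) A = (\<Sum>\<eta>\<in>UNIV. ennreal (z \<eta>))"
      by (simp add: emeasure_vertex_measure[OF t z A(1)])
    also have "\<dots> = 1" using z sum by (simp add: sum_ennreal)
    finally show ?thesis .
  qed
  have "space (vertex_measure (vec t) z) = UNIV" by (simp add: vertex_measure_def)
  then show ?thesis unfolding cube_prob_def
    using *[of UNIV] *[of unit_cube] by (auto intro!: prob_spaceI)
qed

section \<open>Tail nesting as a random map\<close>

lemma AE_cube_prob: "cube_prob V \<Longrightarrow> AE v in V. v \<in> unit_cube"
  unfolding cube_prob_def by (rule prob_space.AE_prob_1) (auto simp: measure_def)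

text \<open>Gluing followed by rescaling is again affine from cube to box, and the new corners are
  the images of the pairs (0,a) and (1,b). Uniform distributions therefore stay uniform on
  boxes.\<close>

lemma box_aff_vec_mix:
  "box_aff l h (vec_mix S (x, box_aff a b y)) =
    box_aff (box_aff l h (vec_mix S (0, a))) (box_aff l h (vec_mix S (1, b))) (vec_mix S (x, y))"
  by (simp add: box_aff_def vec_mix_def vec_eq_iff algebra_simps)

text \<open>If \<open>0 < l$i\<close> then \<open>q \<le> l$i\<close>, and a positive
  \<open>x$i\<close> puts the coordinate strictly above \<open>q\<close>, where it is kept.
  Otherwise the interval is [0,q], the coordinate is at most \<open>q\<close>, and
  \<open>q * v$i\<close> is the affine image of \<open>v$i\<close>. The null set matters on lower
  walls: a point with \<open>x$i = 0\<close> in a box starting exactly at \<open>q\<close> would be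
  taken for a corner point.\<close>

lemma AE_tail_step_box_aff:
  fixes V :: "(real^'r::finite) measure"
  assumes P: "tail_pairs q P" "(l, h) \<in> P" and V: "cube_prob V"
  shows "AE (x, v) in cube_unif \<Otimes>\<^sub>M V. tail_step q (box_aff l h x, v) = box_aff l h (vec_mix {i. 0 < l$i} (x, v))"
proof -
  have pV: "prob_space V" using V by (simp add: cube_prob_def)
  have "AE p in cube_unif \<Otimes>\<^sub>M V. fst p \<in> unit_cube \<and> (\<forall>i. fst p $ i > 0)"
    by (rule AE_pair_fst[OF prob_space_cube_unif pV AE_cube_unif])
  moreover have "AE p in cube_unif \<Otimes>\<^sub>M V. snd p \<in> unit_cube"
    by (rule AE_pair_snd[OF prob_space_cube_unif pV AE_cube_prob[OF V]])
  ultimately show ?thesis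
  proof eventually_elim
    case (elim p)
    obtain x v where p: "p = (x, v)" by (cases p)
    have x: "0 < x$i" "x$i \<le> 1" and v: "0 \<le> v$i" "v$i \<le> 1" for i
      using elim by (auto simp: p unit_cube_def mem_box_cart)
    have q: "q > 0" using P by (simp add: tail_pairs_def)
    have "tail_step q (box_aff l h x, v) $ i = box_aff l h (vec_mix {i. 0 < l$i} (x, v)) $ i" for i
    proof -
      note D = tail_pairsD[OF P, of i]
      show ?thesis
      proof (cases "0 < l$i")
        case True
        then have "q \<le> l$i" using D(4) by simp
        moreover have "x$i * (h$i - l$i) > 0" using x[of i] D(2) by simp
        ultimately show ?thesis using True by (simp add: tail_step_def box_aff_def vec_mix_def)
      next
        case False
        then have lh: "l$i = 0" "h$i = q" using D(1,4) q by auto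
        have "x$i * q \<le> 1 * q" using x[of i] q by (intro mult_right_mono) auto
        then show ?thesis using False v[of i] by (simp add: tail_step_def box_aff_def vec_mix_def lh)
      qed
    qed
    then show ?case by (simp add: p vec_eq_iff)
  qed
qed

text \<open>A grid copula as the mixture of the uniform distributions on its boxes. In the grids
  below, common faces of boxes carry no mass.\<close>

definition grid_uniform :: "(real^'r::finite) measure \<Rightarrow> 'r grid \<Rightarrow> bool" where
  "grid_uniform c \<J> \<longleftrightarrow> (\<forall>A\<in>sets borel.
     emeasure c A = (\<Sum>J\<in>\<J>. emeasure c J * emeasure (uniform_measure lborel J) A))"

lemma emeasure_distr_tail_step:
  assumes P: "tail_pairs q P" "(l, h) \<in> P" and V: "cube_prob V" and A: "A \<in> sets borel"
  shows "emeasure (uniform_measure lborel (cbox l h) \<Otimes>\<^sub>M V) (tail_step q -` A)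
    = emeasure (distr (cube_unif \<Otimes>\<^sub>M V) borel (\<lambda>p. box_aff l h (vec_mix {i. 0 < l$i} p))) A"
proof -
  have pV: "prob_space V" and sV [measurable_cong]: "sets V = sets borel"
    using V by (auto simp: cube_prob_def)
  have spV: "space V = UNIV" using sets_eq_imp_space_eq[OF sV] by simp
  have lh: "l$i < h$i" for i using tail_pairsD(2)[OF P] .
  have "uniform_measure lborel (cbox l h) \<Otimes>\<^sub>M V = distr cube_unif borel (box_aff l h) \<Otimes>\<^sub>M distr V V (\<lambda>x. x)"
    by (simp add: distr_cube_unif_box_aff[OF lh] distr_id)
  also have "\<dots> = distr (cube_unif \<Otimes>\<^sub>M V) (borel \<Otimes>\<^sub>M V) (\<lambda>(x, v). (box_aff l h x, v))"
    by (rule pair_measure_distr) (auto simp: distr_id intro: prob_space_imp_sigma_finite pV)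
  finally have eq: "uniform_measure lborel (cbox l h) \<Otimes>\<^sub>M V = distr (cube_unif \<Otimes>\<^sub>M V) (borel \<Otimes>\<^sub>M V) (\<lambda>(x, v). (box_aff l h x, v))" .
  have "emeasure (uniform_measure lborel (cbox l h) \<Otimes>\<^sub>M V) (tail_step q -` A)
    = emeasure (cube_unif \<Otimes>\<^sub>M V) {p. tail_step q (box_aff l h (fst p), snd p) \<in> A}"
  proof -
    have m: "(\<lambda>(x, v). (box_aff l h x, v)) \<in> (cube_unif \<Otimes>\<^sub>M V) \<rightarrow>\<^sub>M (borel \<Otimes>\<^sub>M V)"
      by measurable
    have "tail_step q \<in> (borel \<Otimes>\<^sub>M V) \<rightarrow>\<^sub>M borel" by measurable
    from measurable_sets[OF this A] have "tail_step q -` A \<in> sets (borel \<Otimes>\<^sub>M V)"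
      by (simp add: space_pair_measure spV)
    from emeasure_distr[OF m this] show ?thesis
      by (simp add: eq space_pair_measure spV vimage_def split_beta')
  qed
  also have "\<dots> = emeasure (cube_unif \<Otimes>\<^sub>M V) {p. box_aff l h (vec_mix {i. 0 < l$i} p) \<in> A}"
  proof (rule emeasure_eq_AE)
    show "AE p in cube_unif \<Otimes>\<^sub>M V. p \<in> {p. tail_step q (box_aff l h (fst p), snd p) \<in> A} \<longleftrightarrow> p \<in> {p. box_aff l h (vec_mix {i. 0 < l$i} p) \<in> A}"
      using AE_tail_step_box_aff[OF P V] by eventually_elim auto
    have "(\<lambda>p. tail_step q (box_aff l h (fst p), snd p)) \<in> (cube_unif \<Otimes>\<^sub>M V) \<rightarrow>\<^sub>M borel" by measurable
    from measurable_sets[OF this A] show "{p. tail_step q (box_aff l h (fst p), snd p) \<in> A} \<in> sets (cube_unif \<Otimes>\<^sub>M V)"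
      by (simp add: space_pair_measure spV vimage_def)
    have "(\<lambda>p. box_aff l h (vec_mix {i. 0 < l$i} p)) \<in> (cube_unif \<Otimes>\<^sub>M V) \<rightarrow>\<^sub>M borel" by measurable
    from measurable_sets[OF this A] show "{p. box_aff l h (vec_mix {i. 0 < l$i} p) \<in> A} \<in> sets (cube_unif \<Otimes>\<^sub>M V)"
      by (simp add: space_pair_measure spV vimage_def)
  qed
  also have "\<dots> = emeasure (distr (cube_unif \<Otimes>\<^sub>M V) borel (\<lambda>p. box_aff l h (vec_mix {i. 0 < l$i} p))) A"
    using A by (subst emeasure_distr) (auto simp: space_pair_measure spV vimage_def)
  finally show ?thesis .
qed

text \<open>Sums over a grid run over sets, those over endpoint pairs over \<open>P\<close>;
  nonempty boxes determine their endpoints, so no term is lost in passing between them.\<close>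

lemma inj_on_tail_pairs:
  assumes P: "tail_pairs q P"
  shows "inj_on (\<lambda>(l, h). cbox l h) (P :: ((real^'r::finite) \<times> (real^'r)) set)"
proof (rule inj_onI, safe)
  fix l h l' h' :: "real^'r"
  assume 1: "(l, h) \<in> P" "(l', h') \<in> P" "cbox l h = cbox l' h'"
  have "cbox l h \<noteq> {}" "cbox l' h' \<noteq> {}"
    using tail_pairsD(2)[OF P 1(1)] tail_pairsD(2)[OF P 1(2)] by (auto simp: interval_ne_empty_cart less_imp_le)
  with 1 show "l = l'" "h = h'"
    by (metis (no_types) eq_cbox)+
qed

lemma sum_boxes:
  assumes P: "tail_pairs q P"
  shows "(\<Sum>J\<in>boxes P. f J) = (\<Sum>(l, h)\<in>P. f (cbox l h))"
  unfolding boxes_def by (subst sum.reindex[OF inj_on_tail_pairs[OF P]]) (simp add: split_beta' o_def)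

lemma emeasure_tail_step_mixture:
  fixes c V :: "(real^'r::finite) measure"
  assumes P: "tail_pairs q P" and c: "prob_space c" "sets c = sets borel" and G: "grid_uniform c (boxes P)"
    and V: "cube_prob V" and A: "A \<in> sets borel"
  shows "emeasure (distr (c \<Otimes>\<^sub>M V) borel (tail_step q)) A = (\<Sum>(l, h)\<in>P. emeasure c (cbox l h) *
     emeasure (distr (cube_unif \<Otimes>\<^sub>M V) borel (\<lambda>p. box_aff l h (vec_mix {i. 0 < l$i} p))) A)"
proof -
  have pV: "prob_space V" and sV: "sets V = sets borel" using V by (auto simp: cube_prob_def)
  have spV: "space V = UNIV" "space c = UNIV"
    using sets_eq_imp_space_eq[OF sV] sets_eq_imp_space_eq[OF c(2)] by simp_all
  note [measurable_cong] = c(2) sV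
  have m: "tail_step q \<in> (c \<Otimes>\<^sub>M V) \<rightarrow>\<^sub>M borel" by measurable
  have Q: "tail_step q -` A \<in> sets (c \<Otimes>\<^sub>M V)"
    using measurable_sets[OF m A] by (simp add: space_pair_measure spV)
  have "emeasure (distr (c \<Otimes>\<^sub>M V) borel (tail_step q)) A = emeasure (c \<Otimes>\<^sub>M V) (tail_step q -` A)"
    by (simp add: emeasure_distr[OF m A] space_pair_measure spV)
  also have "\<dots> = (\<Sum>p\<in>P. emeasure c (cbox (fst p) (snd p)) * emeasure (uniform_measure lborel (cbox (fst p) (snd p)) \<Otimes>\<^sub>M V) (tail_step q -` A))"
  proof (rule emeasure_pair_mixture_fst[OF pV c(1) _ _ _ _ Q])
    show "finite P" using P by (simp add: tail_pairs_def)
    show "prob_space (uniform_measure lborel (cbox (fst p) (snd p)))" if "p \<in> P" for p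
      using that tail_pairsD(2)[OF P, of "fst p" "snd p"] by (intro prob_space_uniform_cbox) auto
    show "emeasure c A = (\<Sum>p\<in>P. emeasure c (cbox (fst p) (snd p)) * emeasure (uniform_measure lborel (cbox (fst p) (snd p))) A)"
      if "A \<in> sets c" for A
      using G that unfolding grid_uniform_def sum_boxes[OF P] by (simp add: c(2) split_beta')
  qed (simp add: c)
  also have "\<dots> = (\<Sum>(l, h)\<in>P. emeasure c (cbox l h) *
     emeasure (distr (cube_unif \<Otimes>\<^sub>M V) borel (\<lambda>p. box_aff l h (vec_mix {i. 0 < l$i} p))) A)"
    using emeasure_distr_tail_step[OF P _ V A] by (auto simp: split_beta' intro!: sum.cong)
  finally show ?thesis .
qed

text \<open>Both sides split over the grid with the same weights. On a single box the random map is
  almost surely gluing followed by the affine map onto the box, and this is the law that nesting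
  places there.\<close>

theorem tnest_measure_eq_distr:
  fixes c :: "(real^'r::finite) measure"
  assumes P: "tail_pairs q P" and c: "prob_space c" "sets c = sets borel" and G: "grid_uniform c (boxes P)"
    and V: "cube_prob (vertex_measure u z)"
  shows "tnest_measure u z (c, boxes P) = distr (c \<Otimes>\<^sub>M vertex_measure u z) borel (tail_step q)"
proof (rule measure_eqI)
  let ?V = "vertex_measure u z"
  have pV: "prob_space ?V" using V by (simp add: cube_prob_def)
  show s: "sets (tnest_measure u z (c, boxes P)) = sets (distr (c \<Otimes>\<^sub>M ?V) borel (tail_step q))"
    by (simp add: tnest_measure_def sets.sigma_sets_eq[of borel, simplified])
  fix A assume "A \<in> sets (tnest_measure u z (c, boxes P))"
  then have A: "A \<in> sets borel" using s by simp
  have "emeasure (tnest_measure u z (c, boxes P)) A = (\<Sum>(l, h)\<in>P. emeasure c (cbox l h) *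
     emeasure (distr (uniformize (box_vertex (cbox l h)) ?V) borel (box_map (cbox l h))) A)"
    by (simp add: emeasure_tnest_measure[OF A] sum_boxes[OF P] split_beta')
  also have "\<dots> = (\<Sum>(l, h)\<in>P. emeasure c (cbox l h) *
     emeasure (distr (cube_unif \<Otimes>\<^sub>M ?V) borel (\<lambda>p. box_aff l h (vec_mix {i. 0 < l$i} p))) A)"
  proof (intro sum.cong refl, safe)
    fix l h assume lh: "(l, h) \<in> P"
    note D = tail_pairsD[OF P lh]
    have le: "l$i \<le> h$i" "0 \<le> h$i" for i using D(1,2)[of i] by simp_all
    show "emeasure c (cbox l h) * emeasure (distr (uniformize (box_vertex (cbox l h)) ?V) borel (box_map (cbox l h))) A
      = emeasure c (cbox l h) * emeasure (distr (cube_unif \<Otimes>\<^sub>M ?V) borel (\<lambda>p. box_aff l h (vec_mix {i. 0 < l$i} p))) A"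
      by (simp add: uniformize_eq[OF pV] box_map_cbox[OF le(1)] box_vertex_cbox[OF le] distr_distr o_def)
  qed
  also have "\<dots> = emeasure (distr (c \<Otimes>\<^sub>M ?V) borel (tail_step q)) A"
    using emeasure_tail_step_mixture[OF P c G V A] by simp
  finally show "emeasure (tnest_measure u z (c, boxes P)) A = emeasure (distr (c \<Otimes>\<^sub>M ?V) borel (tail_step q)) A" .
qed

text \<open>Each grid box lies inside the given box or is separated from it in some coordinate, so
  the grid boxes inside tile the given box up to a null set.\<close>

lemma uniform_box_grid:
  fixes L H :: "real^'r::finite"
  assumes P: "tail_pairs q P" and B: "cbox L H \<subseteq> unit_cube" "\<And>i. L$i < H$i"
    and compat: "\<And>l h. (l, h) \<in> P \<Longrightarrow> cbox l h \<subseteq> cbox L H \<or> (\<exists>i. h$i \<le> L$i \<or> H$i \<le> l$i)"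
  shows "grid_uniform (uniform_measure lborel (cbox L H)) (boxes P)"
  unfolding grid_uniform_def sum_boxes[OF P]
proof
  fix A :: "(real^'r) set" assume A [measurable]: "A \<in> sets borel"
  have fin: "finite P" using P by (simp add: tail_pairs_def)
  let ?B = "cbox L H"
  \<comment> \<open>Off the endpoint hyperplanes a point belongs to at most one grid box, because
    different boxes have intervals without common interior in some coordinate.\<close>
  have AEn: "AE x in lborel. \<forall>i. \<forall>(l, h)\<in>insert (L, H) P. x$i \<noteq> l$i \<and> x$i \<noteq> h$i"
    by (subst AE_all_countable, intro allI, subst AE_finite_all)
      (use fin in \<open>auto simp: AE_lborel_vec_nth_neq split_beta'\<close>)
  have ov: "emeasure lborel (?B \<inter> cbox l h) = 0" if "h$i \<le> L$i \<or> H$i \<le> l$i" for l h i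
  proof -
    have "AE x in lborel. x \<notin> ?B \<inter> cbox l h"
      using AE_lborel_vec_nth_neq[of i "L$i"] AE_lborel_vec_nth_neq[of i "H$i"]
    proof eventually_elim
      case (elim x)
      show ?case
      proof
        assume "x \<in> ?B \<inter> cbox l h"
        then have "L$i \<le> x$i" "x$i \<le> H$i" "l$i \<le> x$i" "x$i \<le> h$i" by (auto simp: mem_box_cart)
        with elim that show False by linarith
      qed
    qed
    then show ?thesis by (subst (asm) AE_iff_measurable[OF _ refl]) (auto simp: Int_def)
  qed
  have "emeasure lborel (?B \<inter> A) = (\<integral>\<^sup>+x. indicator (?B \<inter> A) x \<partial>lborel)"
    by simp
  also have "\<dots> = (\<integral>\<^sup>+x. (\<Sum>p\<in>P. indicator (?B \<inter> A \<inter> cbox (fst p) (snd p)) x) \<partial>lborel)"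
  proof (rule nn_integral_cong_AE)
    show "AE x in lborel. (indicator (?B \<inter> A) x :: ennreal) = (\<Sum>p\<in>P. indicator (?B \<inter> A \<inter> cbox (fst p) (snd p)) x)"
      using AEn
    proof eventually_elim
      case (elim x)
      show ?case
      proof (cases "x \<in> ?B \<inter> A")
        case True
        then have "x \<in> unit_cube" using B by auto
        then obtain l h where lh: "(l, h) \<in> P" "x \<in> cbox l h"
          using P unfolding tail_pairs_def by blast
        have "x \<notin> cbox (fst p) (snd p)" if p: "p \<in> P" "p \<noteq> (l, h)" for p
        proof
          assume x: "x \<in> cbox (fst p) (snd p)"
          obtain l' h' where p': "p = (l', h')" by (cases p)
          with p have "l' \<noteq> l \<or> h' \<noteq> h" by auto
          then obtain i where "l'$i \<noteq> l$i \<or> h'$i \<noteq> h$i" by (auto simp: vec_eq_iff)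
          then have "h$i \<le> l'$i \<or> h'$i \<le> l$i"
            using tail_pairs_cases[OF P lh(1), of l' h' i] p p' by auto
          moreover have "l$i \<le> x$i" "x$i \<le> h$i" "l'$i \<le> x$i" "x$i \<le> h'$i"
            using x lh(2) by (auto simp: p' mem_box_cart)
          moreover have "x$i \<noteq> l$i" "x$i \<noteq> l'$i" using elim lh(1) p p' by auto
          ultimately show False by linarith
        qed
        then have "(\<Sum>p\<in>P. indicator (?B \<inter> A \<inter> cbox (fst p) (snd p)) x :: ennreal) = (\<Sum>p\<in>{(l, h)}. 1)"
          using lh True fin by (intro sum.mono_neutral_cong_right) (auto simp: indicator_def)
        then show ?thesis using True by simp
      next
        case False
        then have "(\<Sum>p\<in>P. indicator (?B \<inter> A \<inter> cbox (fst p) (snd p)) x :: ennreal) = 0"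
          by (intro sum.neutral) (auto simp: indicator_def)
        with False show ?thesis by simp
      qed
    qed
  qed
  also have "\<dots> = (\<Sum>p\<in>P. emeasure lborel (?B \<inter> A \<inter> cbox (fst p) (snd p)))"
    by (subst nn_integral_sum) auto
  also have "\<dots> = (\<Sum>p\<in>P. emeasure lborel (?B \<inter> cbox (fst p) (snd p)) * emeasure (uniform_measure lborel (cbox (fst p) (snd p))) A)"
  proof (intro sum.cong refl)
    fix p assume p: "p \<in> P"
    obtain l h where p': "p = (l, h)" by (cases p)
    consider "cbox l h \<subseteq> ?B" | i where "h$i \<le> L$i \<or> H$i \<le> l$i" using compat p p' by blast
    then have "emeasure lborel (?B \<inter> A \<inter> cbox l h) = emeasure lborel (?B \<inter> cbox l h) * emeasure (uniform_measure lborel (cbox l h)) A"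
    proof cases
      case 1
      have n: "emeasure lborel (cbox l h) \<noteq> 0" "emeasure lborel (cbox l h) \<noteq> \<infinity>"
      proof -
        have "(\<Prod>i\<in>UNIV. h$i - l$i) > 0" using tail_pairsD(2)[OF P] p p' by (intro prod_pos) auto
        then show "emeasure lborel (cbox l h) \<noteq> 0"
          using tail_pairsD(2)[OF P] p p' by (auto simp: emeasure_lborel_cbox_cart prod_ennreal less_imp_le less_imp_neq[THEN not_sym])
      qed (simp add: emeasure_lborel_cbox_eq)
      have "?B \<inter> A \<inter> cbox l h = cbox l h \<inter> A" "?B \<inter> cbox l h = cbox l h" using 1 by auto
      then show ?thesis using n by (simp add: ennreal_times_divide ennreal_mult_divide_eq mult.commute[of "emeasure lborel (cbox l h)"])
    next
      case (2 i)
      have "emeasure lborel (?B \<inter> A \<inter> cbox l h) \<le> emeasure lborel (?B \<inter> cbox l h)"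
        by (rule emeasure_mono) auto
      then show ?thesis using ov[OF 2] by simp
    qed
    then show "emeasure lborel (?B \<inter> A \<inter> cbox (fst p) (snd p)) = emeasure lborel (?B \<inter> cbox (fst p) (snd p)) * emeasure (uniform_measure lborel (cbox (fst p) (snd p))) A"
      by (simp add: p')
  qed
  finally have "emeasure lborel (?B \<inter> A) / emeasure lborel ?B = (\<Sum>p\<in>P. emeasure lborel (?B \<inter> cbox (fst p) (snd p)) / emeasure lborel ?B * emeasure (uniform_measure lborel (cbox (fst p) (snd p))) A)"
    by (simp only: divide_ennreal_def sum_distrib_left mult_ac)
  moreover have "emeasure (uniform_measure lborel ?B) X = emeasure lborel (?B \<inter> X) / emeasure lborel ?B"
    if "X \<in> sets borel" for X
    using that by simp
  moreover have "cbox l h \<in> sets borel" for l h :: "real^'r" by simp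
  ultimately show "emeasure (uniform_measure lborel ?B) A = (\<Sum>(l, h)\<in>P. emeasure (uniform_measure lborel ?B) (cbox l h) * emeasure (uniform_measure lborel (cbox l h)) A)"
    by (simp only: split_beta' A)
qed

lemma grid_uniform_mixture:
  assumes mix: "\<And>A. A \<in> sets borel \<Longrightarrow> emeasure c A = (\<Sum>i\<in>I. w i * emeasure (M i) A)"
    and M: "\<And>i. i \<in> I \<Longrightarrow> grid_uniform (M i) \<J>" and J: "\<And>J. J \<in> \<J> \<Longrightarrow> J \<in> sets borel"
  shows "grid_uniform c \<J>"
  unfolding grid_uniform_def
proof
  fix A :: "(real^'a) set" assume A: "A \<in> sets borel"
  have "emeasure c A = (\<Sum>i\<in>I. \<Sum>J\<in>\<J>. w i * (emeasure (M i) J * emeasure (uniform_measure lborel J) A))"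
    using M A by (simp add: mix grid_uniform_def sum_distrib_left)
  also have "\<dots> = (\<Sum>J\<in>\<J>. (\<Sum>i\<in>I. w i * emeasure (M i) J) * emeasure (uniform_measure lborel J) A)"
    by (subst sum.swap) (simp add: sum_distrib_right mult.assoc)
  also have "\<dots> = (\<Sum>J\<in>\<J>. emeasure c J * emeasure (uniform_measure lborel J) A)"
    using J by (simp add: mix)
  finally show "emeasure c A = (\<Sum>J\<in>\<J>. emeasure c J * emeasure (uniform_measure lborel J) A)" .
qed

lemma emeasure_vec_mix_uniform:
  fixes l h a b :: "real^'r::finite" and S :: "'r set"
  assumes lh: "\<And>i. l$i < h$i" and ab: "\<And>i. a$i < b$i" and A: "A \<in> sets borel"
  defines "f \<equiv> \<lambda>p. box_aff l h (vec_mix S p)"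
  shows "emeasure (distr (cube_unif \<Otimes>\<^sub>M uniform_measure lborel (cbox a b)) borel f) A
    = emeasure (uniform_measure lborel (cbox (f (0, a)) (f (1, b)))) A"
proof -
  have p: "prob_space (uniform_measure lborel (cbox a b))" by (rule prob_space_uniform_cbox[OF ab])
  have "cube_unif \<Otimes>\<^sub>M uniform_measure lborel (cbox a b) = distr cube_unif borel (\<lambda>x. x) \<Otimes>\<^sub>M distr cube_unif borel (box_aff a b)"
    by (subst distr_cube_unif_box_aff[OF ab]) (simp add: distr_id2)
  also have "\<dots> = distr (cube_unif \<Otimes>\<^sub>M cube_unif) (borel \<Otimes>\<^sub>M borel) (\<lambda>(x, y). (x, box_aff a b y))"
    by (rule pair_measure_distr) (auto simp: distr_cube_unif_box_aff[OF ab] intro: prob_space_imp_sigma_finite p)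
  finally have eq: "cube_unif \<Otimes>\<^sub>M uniform_measure lborel (cbox a b) =
    distr (cube_unif \<Otimes>\<^sub>M cube_unif) (borel \<Otimes>\<^sub>M borel) (\<lambda>(x, y). (x, box_aff a b y))" .
  have "distr (cube_unif \<Otimes>\<^sub>M uniform_measure lborel (cbox a b)) borel f =
    distr (cube_unif \<Otimes>\<^sub>M cube_unif) borel (f \<circ> (\<lambda>(x, y). (x, box_aff a b y)))"
    unfolding eq by (rule distr_distr) (unfold f_def, measurable)
  also have "f \<circ> (\<lambda>(x, y). (x, box_aff a b y)) = box_aff (f (0, a)) (f (1, b)) \<circ> vec_mix S"
    by (auto simp: f_def box_aff_vec_mix fun_eq_iff)
  also have "distr (cube_unif \<Otimes>\<^sub>M cube_unif) borel (box_aff (f (0, a)) (f (1, b)) \<circ> vec_mix S)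
    = distr (distr (cube_unif \<Otimes>\<^sub>M cube_unif) borel (vec_mix S)) borel (box_aff (f (0, a)) (f (1, b)))"
    by (subst distr_distr) simp_all
  also have "\<dots> = uniform_measure lborel (cbox (f (0, a)) (f (1, b)))"
    unfolding distr_cube_unif_vec_mix
  proof (rule distr_cube_unif_box_aff)
    fix i
    have "a$i * (h$i - l$i) < b$i * (h$i - l$i)" using lh[of i] ab[of i] by (intro mult_strict_right_mono) auto
    then show "f (0, a) $ i < f (1, b) $ i"
      using lh[of i] by (auto simp: f_def box_aff_def vec_mix_def)
  qed
  finally show ?thesis by simp
qed

lemma boxes_borel: "J \<in> boxes P \<Longrightarrow> J \<in> sets borel"
  by (auto simp: boxes_def)

text \<open>Given an old box and a vertex \<open>\<eta>\<close>, the new law is uniform on a box. It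
  keeps the whole interval in coordinates with positive lower end, where nesting is uniform, and one
  part of the corner interval in the others. The refined grid cuts every coordinate, so it tiles all
  these boxes.\<close>

lemma grid_uniform_tail_step:
  fixes c :: "(real^'r::finite) measure" and z :: "'r vertex \<Rightarrow> real"
  assumes P: "tail_pairs q P" and c: "prob_space c" "sets c = sets borel" and G: "grid_uniform c (boxes P)"
    and t: "0 < t" "t < 1" and z: "\<And>\<eta>. 0 \<le> z \<eta>" and sum: "(\<Sum>\<eta>\<in>UNIV. z \<eta>) = 1"
  shows "grid_uniform (distr (c \<Otimes>\<^sub>M vertex_measure (vec t) z) borel (tail_step q)) (boxes (split_pairs t P))"
proof -
  let ?V = "vertex_measure (vec t) z"
  have V: "cube_prob ?V" by (rule cube_prob_vertex_measure[OF t z sum])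
  then have pV: "prob_space ?V" by (simp add: cube_prob_def)
  define L where "L = (\<lambda>((l, h), \<eta>). box_aff l h (vec_mix {i. 0 < l$i} (0, vlo t \<eta>)) :: real^'r)"
  define H where "H = (\<lambda>((l, h), \<eta>). box_aff l h (vec_mix {i. 0 < l$i} (1, vhi t \<eta>)) :: real^'r)"
  define w where "w = (\<lambda>((l, h), \<eta>). emeasure c (cbox l h) * ennreal (z \<eta>))"

  have mix: "emeasure (distr (c \<Otimes>\<^sub>M ?V) borel (tail_step q)) A =
      (\<Sum>j\<in>P \<times> UNIV. w j * emeasure (uniform_measure lborel (cbox (L j) (H j))) A)" if A: "A \<in> sets borel" for A
  proof -
    have "emeasure (distr (cube_unif \<Otimes>\<^sub>M ?V) borel (\<lambda>p. box_aff l h (vec_mix {i. 0 < l$i} p))) A =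
       (\<Sum>\<eta>\<in>UNIV. ennreal (z \<eta>) * emeasure (uniform_measure lborel (cbox (L ((l, h), \<eta>)) (H ((l, h), \<eta>)))) A)"
      (is "emeasure (distr _ _ ?f) A = _")
      if lh: "(l, h) \<in> P" for l h
    proof -
      have Q: "?f -` A \<in> sets (borel \<Otimes>\<^sub>M borel)"
      proof -
        have "?f \<in> (borel \<Otimes>\<^sub>M borel) \<rightarrow>\<^sub>M borel" by measurable
        from measurable_sets[OF this A] show ?thesis by (simp add: space_pair_measure)
      qed
      have d: "emeasure (distr (cube_unif \<Otimes>\<^sub>M N) borel ?f) A = emeasure (cube_unif \<Otimes>\<^sub>M N) (?f -` A)"
        if N [measurable_cong]: "sets N = sets borel" for N
        using sets_eq_imp_space_eq[OF N] by (subst emeasure_distr) (use A in \<open>auto simp: space_pair_measure\<close>)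
      have Q': "?f -` A \<in> sets (cube_unif \<Otimes>\<^sub>M ?V)"
        using Q sets_pair_measure_cong[of cube_unif borel ?V borel] by simp
      have "emeasure (cube_unif \<Otimes>\<^sub>M ?V) (?f -` A) =
        (\<Sum>\<eta>\<in>UNIV. ennreal (z \<eta>) * emeasure (cube_unif \<Otimes>\<^sub>M uniform_measure lborel (vertex_box (vec t) \<eta>)) (?f -` A))"
        by (rule emeasure_pair_mixture_snd[OF prob_space_cube_unif pV _ _ _ _ Q'])
          (simp_all add: prob_space_uniform_vertex_box t z emeasure_vertex_measure)
      also have "\<dots> = (\<Sum>\<eta>\<in>UNIV. ennreal (z \<eta>) * emeasure (distr (cube_unif \<Otimes>\<^sub>M uniform_measure lborel (vertex_box (vec t) \<eta>)) borel ?f) A)"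
        by (simp add: d)
      also have "\<dots> = (\<Sum>\<eta>\<in>UNIV. ennreal (z \<eta>) * emeasure (uniform_measure lborel (cbox (L ((l, h), \<eta>)) (H ((l, h), \<eta>)))) A)"
        unfolding vertex_box_eq L_def H_def prod.case
        by (subst emeasure_vec_mix_uniform) (use tail_pairsD[OF P lh] vlo_less_vhi[OF t] A in auto)
      finally show ?thesis by (simp add: d)
    qed
    then show ?thesis
      unfolding emeasure_tail_step_mixture[OF P c G V A]
      by (auto simp: sum.cartesian_product w_def split_beta' sum_distrib_left mult.assoc intro!: sum.cong)
  qed
  show ?thesis
  proof (rule grid_uniform_mixture[OF mix])
    fix j :: "((real^'r) \<times> (real^'r)) \<times> 'r set" assume "j \<in> P \<times> UNIV"
    then obtain l h \<eta> where j: "j = ((l, h), \<eta>)" and lh: "(l, h) \<in> P" by (cases j) auto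
    note D = tail_pairsD[OF P lh]
    have LH: "L j $ i = (if 0 < l$i then l$i else box_aff l h (vlo t \<eta>) $ i)"
      "H j $ i = (if 0 < l$i then h$i else box_aff l h (vhi t \<eta>) $ i)" for i
      by (auto simp: L_def H_def j vec_mix_def box_aff_def)
    have sub: "l$i \<le> L j $ i \<and> L j $ i < H j $ i \<and> H j $ i \<le> h$i" for i
      unfolding LH box_aff_vlo_nth box_aff_vhi_nth
      using D(2)[of i] split_point[OF D(2)[of i] t] by auto
    show "grid_uniform (uniform_measure lborel (cbox (L j) (H j))) (boxes (split_pairs t P))"
    proof (rule uniform_box_grid[OF tail_pairs_split[OF P t]])
      show "cbox (L j) (H j) \<subseteq> unit_cube"
        unfolding unit_cube_def
      proof (rule subset_interval_imp_cart(1), intro allI)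
        fix i show "(0 :: real^'r) $ i \<le> L j $ i \<and> H j $ i \<le> (1 :: real^'r) $ i"
          using sub[of i] D(1,3)[of i] by simp
      qed
      show "L j $ i < H j $ i" for i using sub by simp
      fix l2 h2 assume "(l2, h2) \<in> split_pairs t P"
      then obtain l' h' \<eta>' where lh': "(l', h') \<in> P" and 2: "l2 = box_aff l' h' (vlo t \<eta>')" "h2 = box_aff l' h' (vhi t \<eta>')"
        by (auto simp: split_pairs_def)
      note D' = tail_pairsD[OF P lh']
      \<comment> \<open>It suffices to compare intervals: either the refined interval is inside in
        every coordinate, which gives inclusion, or some coordinate separates the two boxes.\<close>
      have "L j $ i \<le> l2 $ i \<and> h2 $ i \<le> H j $ i \<or> h2$i \<le> L j $ i \<or> H j $ i \<le> l2$i" for i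
      proof -
        have s: "l'$i \<le> l2$i" "h2$i \<le> h'$i"
          using D'(2)[of i] split_point[OF D'(2)[of i] t] by (auto simp: 2 box_aff_vlo_nth box_aff_vhi_nth)
        consider "l$i = l'$i" "h$i = h'$i" | "h$i \<le> l'$i" | "h'$i \<le> l$i"
          using tail_pairs_cases[OF P lh lh', of i] by blast
        then show ?thesis
        proof cases
          case 1
          show ?thesis
          proof (cases "0 < l$i")
            case True
            then show ?thesis using s 1 by (simp add: LH)
          next
            case False
            then show ?thesis unfolding LH 2 box_aff_vlo_nth box_aff_vhi_nth using 1
              by (cases "i \<in> \<eta>"; cases "i \<in> \<eta>'") auto
          qed
        qed (use s sub[of i] in linarith)+
      qed
      then show "cbox l2 h2 \<subseteq> cbox (L j) (H j) \<or> (\<exists>i. h2$i \<le> L j $ i \<or> H j $ i \<le> l2$i)"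
        by (meson subset_interval_imp_cart(1))
    qed
  qed (assumption | rule boxes_borel)+
qed

text \<open>Prefixing the sequence by the uniform copula on the trivial grid makes its first term
  an instance of the recursion.\<close>

primrec nested_copula :: "real \<Rightarrow> (nat \<Rightarrow> 'r::finite vertex \<Rightarrow> real) \<Rightarrow> nat \<Rightarrow> (real^'r) measure" where
  "nested_copula t z 0 = cube_unif"
| "nested_copula t z (Suc n) = distr (nested_copula t z n \<Otimes>\<^sub>M vertex_measure (vec t) (z (Suc n))) borel (tail_step (t ^ n))"

primrec nested_pairs :: "real \<Rightarrow> nat \<Rightarrow> ((real^'r::finite) \<times> (real^'r)) set" where
  "nested_pairs t 0 = {(0, 1)}"
| "nested_pairs t (Suc n) = split_pairs t (nested_pairs t n)"

locale vertex_seq =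
  fixes t :: real and z :: "nat \<Rightarrow> 'r::finite vertex \<Rightarrow> real"
  assumes t: "0 < t" "t < 1"
    and z_nonneg: "\<And>n \<eta>. 0 \<le> z n \<eta>"
    and z_sum: "\<And>n. (\<Sum>\<eta>\<in>UNIV. z n \<eta>) = 1"
begin

abbreviation V :: "nat \<Rightarrow> (real^'r) measure" where "V n \<equiv> vertex_measure (vec t) (z n)"

lemma cube_prob_V: "cube_prob (V n)"
  by (rule cube_prob_vertex_measure[OF t z_nonneg z_sum])

lemma prob_space_V: "prob_space (V n)"
  using cube_prob_V by (simp add: cube_prob_def)

lemma sets_nested_copula [simp, measurable_cong]: "sets (nested_copula t z n) = sets borel"
  by (cases n) simp_all

lemma prob_space_nested_copula: "prob_space (nested_copula t z n)"
proof (induction n)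
  case 0 then show ?case by (simp add: prob_space_cube_unif)
next
  case (Suc n)
  interpret C: prob_space "nested_copula t z n" by fact
  interpret V: prob_space "V (Suc n)" by (rule prob_space_V)
  interpret pair_prob_space "nested_copula t z n" "V (Suc n)" ..
  show ?case unfolding nested_copula.simps by (rule prob_space_distr) measurable
qed

lemma tail_pairs_nested_pairs: "tail_pairs (t ^ n) (nested_pairs t n :: ((real^'r) \<times> (real^'r)) set)"
proof (induction n)
  case 0 then show ?case by (auto simp: tail_pairs_def unit_cube_def)
qed (use tail_pairs_split[OF _ t] in auto)

lemma grid_uniform_nested_copula: "grid_uniform (nested_copula t z n) (boxes (nested_pairs t n))"
proof (induction n)
  case 0
  have "emeasure (cube_unif :: (real^'r) measure) unit_cube = 1"
    by (rule emeasure_uniform_measure_1) (simp_all add: unit_cube_def emeasure_lborel_cbox_cart)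
  then show ?case by (simp add: grid_uniform_def boxes_def unit_cube_def)
next
  case (Suc n)
  then show ?case
    using grid_uniform_tail_step[OF tail_pairs_nested_pairs prob_space_nested_copula sets_nested_copula Suc t z_nonneg z_sum] by simp
qed

lemma tnest_nested_copula:
  "tnest (vec t) (z (Suc n)) (nested_copula t z n, boxes (nested_pairs t n)) = (nested_copula t z (Suc n), boxes (nested_pairs t (Suc n)))"
  by (simp add: tnest_def tnest_measure_eq_distr[OF tail_pairs_nested_pairs prob_space_nested_copula sets_nested_copula grid_uniform_nested_copula cube_prob_V]
    tnest_grid_boxes[OF tail_pairs_nested_pairs])

text \<open>The threshold is \<open>t ^ 0 = 1\<close>, which no coordinate of a uniform point
  exceeds, so the first step forgets the prefixed uniform copula.\<close>

lemma nested_copula_1: "nested_copula t z (Suc 0) = V (Suc 0)"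
proof -
  interpret C: prob_space "cube_unif :: (real^'r) measure" by (rule prob_space_cube_unif)
  interpret V: prob_space "V (Suc 0)" by (rule prob_space_V)
  interpret pair_prob_space "cube_unif :: (real^'r) measure" "V (Suc 0)" ..
  interpret Q: pair_prob_space "V (Suc 0)" "cube_unif :: (real^'r) measure" ..
  have ae: "AE p in cube_unif \<Otimes>\<^sub>M V (Suc 0). tail_step 1 p = snd p"
    using AE_pair_snd[OF prob_space_cube_unif prob_space_V AE_cube_prob[OF cube_prob_V[of "Suc 0"]]]
       AE_pair_fst[OF prob_space_cube_unif prob_space_V[of "Suc 0"] AE_cube_unif]
  proof eventually_elim
    case (elim p)
    have "tail_step 1 p $ i = snd p $ i" for i
    proof -
      have "fst p $ i \<le> 1" "0 \<le> snd p $ i" "snd p $ i \<le> 1"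
        using elim by (auto simp: unit_cube_def mem_box_cart)
      then show ?thesis by (simp add: tail_step_def split_beta')
    qed
    then show ?case by (simp add: vec_eq_iff)
  qed
  have "nested_copula t z (Suc 0) = distr (cube_unif \<Otimes>\<^sub>M V (Suc 0)) borel (\<lambda>p. tail_step 1 p)" by simp
  also have "\<dots> = distr ((cube_unif :: (real^'r) measure) \<Otimes>\<^sub>M V (Suc 0)) borel snd"
    by (rule distr_cong_AE[OF refl refl ae]) simp_all
  also have "\<dots> = distr (V (Suc 0) \<Otimes>\<^sub>M (cube_unif :: (real^'r) measure)) borel (snd \<circ> (\<lambda>(x, y). (y, x)))"
    by (subst distr_pair_swap) (simp add: distr_distr)
  also have "snd \<circ> (\<lambda>(x, y). (y, x)) = (fst :: (real^'r) \<times> (real^'r) \<Rightarrow> _)" by auto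
  also have "distr (V (Suc 0) \<Otimes>\<^sub>M (cube_unif :: (real^'r) measure)) borel fst = distr (V (Suc 0) \<Otimes>\<^sub>M (cube_unif :: (real^'r) measure)) (V (Suc 0)) fst"
    by (rule distr_cong) simp_all
  also have "\<dots> = V (Suc 0)"
    by (simp add: C.distr_pair_fst C.emeasure_space_1 scale_measure_1 del: space_uniform_measure space_borel)
  finally show ?thesis .
qed

text \<open>The shift by one arises because \<open>tnest_seq\<close> starts with the first vertex
  copula and \<open>nested_copula\<close> with the uniform one before it.\<close>

lemma tnest_seq_eq: "tnest_seq (\<lambda>n. vec t) z n = (nested_copula t z (Suc n), boxes (nested_pairs t (Suc n)))"
proof (induction n)
  case 0
  have "range (vertex_box (vec t)) = boxes (nested_pairs t (Suc 0) :: ((real^'r) \<times> (real^'r)) set)"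
    by (force simp: boxes_def split_pairs_def vertex_box_eq box_aff_def image_iff)
  then show ?case using nested_copula_1 by (simp del: nested_copula.simps nested_pairs.simps(2))
next
  case (Suc n)
  then show ?case using tnest_nested_copula[of "Suc n"] by (simp del: nested_copula.simps nested_pairs.simps)
qed

end

section \<open>The limit copula and its corner masses\<close>

text \<open>With the coordinates outside \<open>\<nu>\<close> left free, the corner mass of a face
  marginal becomes a mass of the copula itself; see
  \<open>measure_face_marginal_scaled_face\<close>.\<close>

definition orthant :: "'r set \<Rightarrow> real \<Rightarrow> (real^'r) set" where
  "orthant \<nu> s = {x. \<forall>i\<in>\<nu>. x$i \<le> s}"

lemma orthant_borel [measurable]: "orthant \<nu> s \<in> sets (borel :: (real^'r::finite) measure)"
  unfolding orthant_def by measurable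

text \<open>The part of the box off the walls \<open>x$i = t\<close> lies in the corner if
  \<open>\<eta>\<close> avoids \<open>\<nu>\<close>; otherwise box and corner meet only within such
  a wall.\<close>

lemma measure_uniform_vertex_box_orthant:
  fixes \<nu> \<eta> :: "'r::finite set"
  assumes t: "0 < t" "t < 1"
  shows "measure (uniform_measure lborel (vertex_box (vec t) \<eta>)) (orthant \<nu> t) = (if \<eta> \<inter> \<nu> = {} then 1 else 0)"
proof -
  interpret prob_space "uniform_measure lborel (vertex_box (vec t) \<eta>)"
    by (rule prob_space_uniform_vertex_box[OF t])
  have ae: "AE x in uniform_measure lborel (vertex_box (vec t) \<eta>). x \<in> vertex_box (vec t) \<eta> \<and> (\<forall>i. x$i \<noteq> t)"
  proof (rule AE_uniform_measureI)
    have "AE x in lborel. \<forall>i. (x :: real^'r) $ i \<noteq> t"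
      by (subst AE_all_countable) (simp add: AE_lborel_vec_nth_neq)
    then show "AE x in lborel. x \<in> vertex_box (vec t) \<eta> \<longrightarrow> x \<in> vertex_box (vec t) \<eta> \<and> (\<forall>i. x$i \<noteq> t)"
      by eventually_elim auto
  qed simp
  show ?thesis
  proof (cases "\<eta> \<inter> \<nu> = {}")
    case True
    have "AE x in uniform_measure lborel (vertex_box (vec t) \<eta>). x \<in> orthant \<nu> t"
      using ae by eventually_elim
        (use True in \<open>auto simp: orthant_def vertex_box_eq mem_box_cart vhi_def split: if_splits\<close>)
    then show ?thesis using True by (subst (asm) prob_eq_1[symmetric]) auto
  next
    case False
    then obtain i where i: "i \<in> \<eta>" "i \<in> \<nu>" by auto
    have "AE x in uniform_measure lborel (vertex_box (vec t) \<eta>). x \<notin> orthant \<nu> t"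
      using ae
    proof eventually_elim
      case (elim x)
      then have "t \<le> x$i" "x$i \<noteq> t" using i by (auto simp: vertex_box_eq mem_box_cart vlo_def split: if_splits)
      then show ?case using i by (auto simp: orthant_def intro!: bexI[of _ i])
    qed
    then show ?thesis using False by (subst (asm) prob_eq_0[symmetric]) auto
  qed
qed

lemma measure_vertex_measure_orthant:
  fixes z :: "'r::finite vertex \<Rightarrow> real"
  assumes t: "0 < t" "t < 1" and z: "\<And>\<eta>. 0 \<le> z \<eta>"
  shows "measure (vertex_measure (vec t) z) (orthant \<nu> t) = (\<Sum>\<eta> | \<eta> \<inter> \<nu> = {}. z \<eta>)"
proof -
  have "emeasure (uniform_measure lborel (vertex_box (vec t) \<eta>)) (orthant \<nu> t) = (if \<eta> \<inter> \<nu> = {} then 1 else 0)" for \<eta>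
  proof -
    interpret prob_space "uniform_measure lborel (vertex_box (vec t) \<eta>)"
      by (rule prob_space_uniform_vertex_box[OF t])
    show ?thesis
      unfolding emeasure_eq_measure measure_uniform_vertex_box_orthant[OF t] by simp
  qed
  then have "emeasure (vertex_measure (vec t) z) (orthant \<nu> t) = (\<Sum>\<eta>\<in>UNIV. if \<eta> \<inter> \<nu> = {} then ennreal (z \<eta>) else 0)"
    unfolding emeasure_vertex_measure[OF t z orthant_borel] by (intro sum.cong) simp_all
  also have "\<dots> = ennreal (\<Sum>\<eta> | \<eta> \<inter> \<nu> = {}. z \<eta>)"
    using z by (simp add: sum.If_cases sum_ennreal)
  finally show ?thesis using z by (simp add: measure_def sum_nonneg)
qed

context vertex_seq begin

lemma AE_V: "AE v in V n. v \<in> unit_cube"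
  by (rule AE_cube_prob[OF cube_prob_V])

text \<open>For \<open>v\<close> in the cube, a coordinate after the step is at most
  \<open>t ^ n * s\<close> exactly when the old one is at most \<open>t ^ n\<close> and that of
  \<open>v\<close> at most \<open>s\<close>. Independence turns this into a product.\<close>

lemma nested_copula_Suc_orthant:
  assumes s: "0 \<le> s" "s \<le> 1"
  shows "measure (nested_copula t z (Suc n)) (orthant \<nu> (t ^ n * s)) =
    measure (nested_copula t z n) (orthant \<nu> (t ^ n)) * measure (V (Suc n)) (orthant \<nu> s)"
proof -
  interpret C: prob_space "nested_copula t z n" by (rule prob_space_nested_copula)
  interpret V: prob_space "V (Suc n)" by (rule prob_space_V)
  interpret pair_prob_space "nested_copula t z n" "V (Suc n)" ..
  have q: "0 < t ^ n" using t by simp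
  have sp: "space (nested_copula t z n) = UNIV" "space (V (Suc n)) = UNIV"
    using sets_eq_imp_space_eq[OF sets_nested_copula, of n] sets_eq_imp_space_eq[OF sets_vertex_measure, of "vec t" "z (Suc n)"] by simp_all
  have m: "tail_step (t ^ n) \<in> (nested_copula t z n \<Otimes>\<^sub>M V (Suc n)) \<rightarrow>\<^sub>M borel" by measurable
  have "measure (nested_copula t z (Suc n)) (orthant \<nu> (t ^ n * s)) = measure (nested_copula t z n \<Otimes>\<^sub>M V (Suc n)) (tail_step (t ^ n) -` orthant \<nu> (t ^ n * s))"
    by (simp add: measure_distr[OF m] space_pair_measure sp)
  also have "\<dots> = measure (nested_copula t z n \<Otimes>\<^sub>M V (Suc n)) (orthant \<nu> (t ^ n) \<times> orthant \<nu> s)"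
  proof (rule finite_measure_eq_AE)
    show "AE p in nested_copula t z n \<Otimes>\<^sub>M V (Suc n). p \<in> tail_step (t ^ n) -` orthant \<nu> (t ^ n * s) \<longleftrightarrow> p \<in> orthant \<nu> (t ^ n) \<times> orthant \<nu> s"
      using AE_pair_snd[OF prob_space_nested_copula[of n] prob_space_V AE_V[of "Suc n"]]
    proof eventually_elim
      case (elim p)
      obtain x v where p: "p = (x, v)" by (cases p)
      have v: "0 \<le> v$i" "v$i \<le> 1" for i using elim by (auto simp: p unit_cube_def mem_box_cart)
      have "tail_step (t ^ n) (x, v) $ i \<le> t ^ n * s \<longleftrightarrow> x$i \<le> t ^ n \<and> v$i \<le> s" for i
      proof (cases "x$i \<le> t ^ n")
        case True
        then show ?thesis using v[of i] q by (simp add: tail_step_def)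
      next
        case False
        have "t ^ n * s \<le> t ^ n * 1" using s q by (intro mult_left_mono) auto
        then show ?thesis using False by (simp add: tail_step_def)
      qed
      then show ?case by (auto simp: p orthant_def)
    qed
    show "tail_step (t ^ n) -` orthant \<nu> (t ^ n * s) \<in> sets (nested_copula t z n \<Otimes>\<^sub>M V (Suc n))"
      using measurable_sets[OF m, of "orthant \<nu> (t ^ n * s)"] by (simp add: space_pair_measure sp)
    show "orthant \<nu> (t ^ n) \<times> orthant \<nu> s \<in> sets (nested_copula t z n \<Otimes>\<^sub>M V (Suc n))" by simp
  qed
  also have "\<dots> = measure (nested_copula t z n) (orthant \<nu> (t ^ n)) * measure (V (Suc n)) (orthant \<nu> s)"
    unfolding measure_def by (subst V.emeasure_pair_measure_Times) (simp_all add: enn2real_mult)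
  finally show ?thesis .
qed

lemma nested_copula_orthant: "measure (nested_copula t z n) (orthant \<nu> (t ^ n)) = (\<Prod>m\<in>{1..n}. \<Sum>\<eta> | \<eta> \<inter> \<nu> = {}. z m \<eta>)"
proof (induction n)
  case 0
  interpret prob_space "cube_unif :: (real^'r) measure" by (rule prob_space_cube_unif)
  have "AE x in cube_unif. x \<in> orthant \<nu> 1"
    using AE_cube_unif by eventually_elim (auto simp: orthant_def unit_cube_def mem_box_cart)
  then have "prob (orthant \<nu> 1) = 1" by (subst prob_eq_1) auto
  then show ?case by simp
next
  case (Suc n)
  have "measure (nested_copula t z (Suc n)) (orthant \<nu> (t ^ Suc n)) = measure (nested_copula t z n) (orthant \<nu> (t ^ n)) * measure (V (Suc n)) (orthant \<nu> t)"
    using nested_copula_Suc_orthant[of t n \<nu>] t by (simp add: mult.commute)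
  then show ?case using Suc by (simp add: measure_vertex_measure_orthant[OF t z_nonneg])
qed

section \<open>Coupling of all stages on one product space\<close>

abbreviation \<Omega> :: "(nat \<Rightarrow> real^'r) measure" where "\<Omega> \<equiv> \<Pi>\<^sub>M n\<in>UNIV. V (Suc n)"

text \<open>The start value 0 lies below the threshold \<open>t ^ 0\<close>, so the first step
  replaces every coordinate by the clipped one of \<open>\<omega> 0\<close>, just as it would for a
  uniform start. Factor \<open>n\<close> of the product carries the vertex copula of index
  \<open>Suc n\<close>.\<close>

primrec X :: "nat \<Rightarrow> (nat \<Rightarrow> real^'r) \<Rightarrow> real^'r" where
  "X 0 \<omega> = 0"
| "X (Suc n) \<omega> = tail_step (t ^ n) (X n \<omega>, \<omega> n)"

lemma X_Suc_nth: "X (Suc n) \<omega> $ i = (if X n \<omega> $ i > t ^ n then X n \<omega> $ i else t ^ n * max 0 (min 1 (\<omega> n $ i)))"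
  by (simp add: tail_step_def)

lemma X_bounds: "0 \<le> X n \<omega> $ i \<and> X n \<omega> $ i \<le> 1"
proof (induction n)
  case (Suc n)
  have "0 \<le> t ^ n" "t ^ n \<le> 1" using t by (simp_all add: power_le_one)
  moreover have "t ^ n * max 0 (min 1 (\<omega> n $ i)) \<le> 1 * 1"
    using t by (intro mult_mono) (simp_all add: power_le_one)
  ultimately show ?case using Suc by (simp add: X_Suc_nth del: X.simps)
qed simp

text \<open>Thresholds decrease, so a coordinate above its threshold is above all later ones and is
  frozen.\<close>

lemma X_stable:
  assumes "m \<ge> n" "X n \<omega> $ i > t ^ n"
  shows "X m \<omega> $ i = X n \<omega> $ i"
  using assms(1)
proof (induction m rule: dec_induct)
  case (step m)
  have "t ^ m \<le> t ^ n" using t step by (intro power_decreasing) auto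
  then show ?case using step assms(2) by (simp add: X_Suc_nth del: X.simps)
qed simp

lemma X_small:
  assumes "m \<ge> n" "X n \<omega> $ i \<le> t ^ n"
  shows "X m \<omega> $ i \<le> t ^ n"
  using assms(1)
proof (induction m rule: dec_induct)
  case (step m)
  have "t ^ m \<le> t ^ n" using t step by (intro power_decreasing) auto
  moreover have "t ^ m * max 0 (min 1 (\<omega> m $ i)) \<le> t ^ m * 1"
    using t by (intro mult_left_mono) auto
  ultimately show ?case using step by (simp add: X_Suc_nth del: X.simps)
qed (use assms in simp)

definition Xlim :: "(nat \<Rightarrow> real^'r) \<Rightarrow> real^'r" where
  "Xlim \<omega> = (\<chi> i. lim (\<lambda>n. X n \<omega> $ i))"

text \<open>Either the coordinate exceeds some threshold and is frozen, or it is squeezed between 0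
  and \<open>t ^ n\<close>.\<close>

lemma X_tendsto_nth: "(\<lambda>n. X n \<omega> $ i) \<longlonglongrightarrow> Xlim \<omega> $ i"
proof -
  have "convergent (\<lambda>n. X n \<omega> $ i)"
  proof (cases "\<exists>n. X n \<omega> $ i > t ^ n")
    case True
    then obtain n where "X n \<omega> $ i > t ^ n" by blast
    then have "eventually (\<lambda>m. X m \<omega> $ i = X n \<omega> $ i) sequentially"
      using X_stable by (auto intro: eventually_sequentiallyI[of n])
    then show ?thesis unfolding convergent_def by (blast intro: tendsto_eventually)
  next
    case False
    have "(\<lambda>n. t ^ n) \<longlonglongrightarrow> 0" using t by (intro LIMSEQ_realpow_zero) auto
    then have "(\<lambda>n. X n \<omega> $ i) \<longlonglongrightarrow> 0"
      by (rule tendsto_sandwich[OF _ _ tendsto_const, rotated 2]) (use False X_bounds in \<open>auto simp: not_less\<close>)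
    then show ?thesis by (auto simp: convergent_def)
  qed
  then show ?thesis by (simp add: Xlim_def convergent_LIMSEQ_iff)
qed

text \<open>Levels from \<open>t ^ n\<close> upwards are decided at stage \<open>n\<close>: a
  coordinate above the threshold is final, and one below it never rises above \<open>t ^ n\<close>
  again. Corner masses of the limit can thus be read off at a finite stage.\<close>

lemma Xlim_le_iff:
  assumes "t ^ n \<le> s"
  shows "Xlim \<omega> $ i \<le> s \<longleftrightarrow> X n \<omega> $ i \<le> s"
proof (cases "X n \<omega> $ i > t ^ n")
  case True
  then have "eventually (\<lambda>m. X m \<omega> $ i = X n \<omega> $ i) sequentially"
    using X_stable by (auto intro: eventually_sequentiallyI[of n])
  then have "Xlim \<omega> $ i = X n \<omega> $ i"
    by (intro LIMSEQ_unique[OF X_tendsto_nth] tendsto_eventually)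
  then show ?thesis by simp
next
  case False
  then have "Xlim \<omega> $ i \<le> t ^ n"
    using X_small by (intro LIMSEQ_le_const2[OF X_tendsto_nth] exI[of _ n]) (auto simp: not_less)
  then show ?thesis using False assms by simp
qed

lemma Xlim_in_cube: "Xlim \<omega> \<in> unit_cube"
proof -
  have "0 \<le> Xlim \<omega> $ i" "Xlim \<omega> $ i \<le> 1" for i
    using X_bounds by (auto intro!: LIMSEQ_le_const[OF X_tendsto_nth] LIMSEQ_le_const2[OF X_tendsto_nth])
  then show ?thesis by (simp add: unit_cube_def mem_box_cart)
qed

text \<open>The index set is a parameter because \<open>distr_X\<close> also needs measurability on
  the product with one factor removed.\<close>

lemma measurable_X [measurable]:
  assumes "{..<n} \<subseteq> I"
  shows "X n \<in> (\<Pi>\<^sub>M n\<in>I. V (Suc n)) \<rightarrow>\<^sub>M borel"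
  using assms
proof (induction n)
  case (Suc n)
  from Suc.prems have "{..<n} \<subseteq> I" by auto
  then have [measurable]: "X n \<in> (\<Pi>\<^sub>M n\<in>I. V (Suc n)) \<rightarrow>\<^sub>M borel" by (rule Suc.IH)
  have "n \<in> I" using Suc by auto
  then have "(\<lambda>\<omega>. \<omega> n) \<in> (\<Pi>\<^sub>M n\<in>I. V (Suc n)) \<rightarrow>\<^sub>M V (Suc n)" by (rule measurable_component_singleton)
  then have [measurable]: "(\<lambda>\<omega>. \<omega> n) \<in> (\<Pi>\<^sub>M n\<in>I. V (Suc n)) \<rightarrow>\<^sub>M borel"
    using measurable_cong_sets[OF refl sets_vertex_measure] by blast
  have "X (Suc n) = (\<lambda>\<omega>. tail_step (t ^ n) (X n \<omega>, \<omega> n))" by auto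
  then show ?case by simp
next
  case 0
  have "X 0 = (\<lambda>\<omega>. 0)" by auto
  then show ?case by simp
qed

lemma X_fun_upd: "n \<le> m \<Longrightarrow> X n (fun_upd \<omega> m x) = X n \<omega>"
  by (induction n) auto

lemma prob_space_\<Omega>: "prob_space \<Omega>"
  by (rule prob_space_PiM) (rule prob_space_V)

text \<open>\<open>X n\<close> depends only on the factors before \<open>n\<close>. Splitting off
  factor \<open>n\<close> shows that \<open>X n\<close> and \<open>\<omega> n\<close> are
  independent, which is one step of the recursion for \<open>nested_copula\<close>. Indices start at
  \<open>Suc n\<close> because \<open>X 0\<close> is the constant 0, whereas stage 0 of
  \<open>nested_copula\<close> is uniform.\<close>

lemma distr_X: "distr \<Omega> borel (X (Suc n)) = nested_copula t z (Suc n)"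
proof (induction n)
  case 0
  have c: "distr \<Omega> (V (Suc 0)) (\<lambda>\<omega>. \<omega> 0) = V (Suc 0)"
    using distr_PiM_component[of UNIV "\<lambda>n. V (Suc n)" 0] prob_space_V by simp
  have mc: "(\<lambda>\<omega>. \<omega> 0) \<in> \<Omega> \<rightarrow>\<^sub>M V (Suc 0)" by (rule measurable_component_singleton) simp
  then have mb: "(\<lambda>\<omega>. \<omega> 0) \<in> \<Omega> \<rightarrow>\<^sub>M borel"
    using measurable_cong_sets[OF refl sets_vertex_measure] by blast
  have "AE \<omega> in \<Omega>. \<omega> 0 \<in> unit_cube"
    by (rule AE_PiM_component) (simp_all add: prob_space_V AE_V)
  then have "AE \<omega> in \<Omega>. X (Suc 0) \<omega> = \<omega> 0"
    by eventually_elim (auto simp: tail_step_def vec_eq_iff unit_cube_def mem_box_cart)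
  then have "distr \<Omega> borel (X (Suc 0)) = distr \<Omega> (V (Suc 0)) (\<lambda>\<omega>. \<omega> 0)"
    by (intro distr_cong_AE refl) (use measurable_X[of "Suc 0" UNIV] mc in \<open>auto simp del: X.simps\<close>)
  then show ?case using c nested_copula_1 by (simp del: X.simps nested_copula.simps)
next
  case (Suc n)
  let ?n = "Suc n"
  let ?W = "\<Pi>\<^sub>M m\<in>UNIV - {?n}. V (Suc m)"
  interpret W: prob_space ?W by (rule prob_space_PiM) (rule prob_space_V)
  interpret V: prob_space "V (Suc ?n)" by (rule prob_space_V)
  interpret WV: pair_prob_space ?W "V (Suc ?n)" ..
  interpret VW: pair_prob_space "V (Suc ?n)" ?W ..
  have [measurable]: "X ?n \<in> ?W \<rightarrow>\<^sub>M borel" by (rule measurable_X) auto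
  have XO [measurable]: "X m \<in> \<Omega> \<rightarrow>\<^sub>M borel" for m by (rule measurable_X) simp
  have eq: "distr (V (Suc ?n) \<Otimes>\<^sub>M ?W) \<Omega> (\<lambda>(x, \<omega>). fun_upd \<omega> ?n x) = \<Omega>"
    using distr_pair_PiM_eq_PiM[of "UNIV - {?n}" "\<lambda>n. V (Suc n)" ?n] prob_space_V by (simp add: insert_absorb)
  have mu: "(\<lambda>(x, \<omega>). fun_upd \<omega> ?n x) \<in> (V (Suc ?n) \<Otimes>\<^sub>M ?W) \<rightarrow>\<^sub>M \<Omega>"
    using measurable_fun_upd[of UNIV "UNIV - {?n}" ?n snd "V (Suc ?n) \<Otimes>\<^sub>M ?W" "\<lambda>n. V (Suc n)" fst]
    by (simp add: split_beta' insert_absorb)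
  have law: "distr \<Omega> borel f = distr (?W \<Otimes>\<^sub>M V (Suc ?n)) borel (\<lambda>(\<omega>, x). f (fun_upd \<omega> ?n x))"
    if f [measurable]: "f \<in> \<Omega> \<rightarrow>\<^sub>M borel" for f :: "_ \<Rightarrow> real^'r"
  proof -
    have "distr \<Omega> borel f = distr (V (Suc ?n) \<Otimes>\<^sub>M ?W) borel (f \<circ> (\<lambda>(x, \<omega>). fun_upd \<omega> ?n x))"
      by (subst eq[symmetric], subst distr_distr[OF f mu]) simp
    also have "\<dots> = distr (?W \<Otimes>\<^sub>M V (Suc ?n)) borel (f \<circ> (\<lambda>(x, \<omega>). fun_upd \<omega> ?n x) \<circ> (\<lambda>(\<omega>, x). (x, \<omega>)))"
      by (subst VW.distr_pair_swap, subst distr_distr) (use mu f in \<open>auto intro: measurable_comp\<close>)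
    also have "f \<circ> (\<lambda>(x, \<omega>). fun_upd \<omega> ?n x) \<circ> (\<lambda>(\<omega>, x). (x, \<omega>)) = (\<lambda>(\<omega>, x). f (fun_upd \<omega> ?n x))"
      by auto
    finally show ?thesis .
  qed
  have "distr \<Omega> borel (X ?n) = distr (?W \<Otimes>\<^sub>M V (Suc ?n)) borel (\<lambda>p. X ?n (fst p))"
    unfolding law[OF XO] by (simp add: X_fun_upd split_beta' del: X.simps)
  also have "\<dots> = distr (distr (?W \<Otimes>\<^sub>M V (Suc ?n)) ?W fst) borel (X ?n)"
    by (subst distr_distr) (simp_all add: o_def)
  also have "distr (?W \<Otimes>\<^sub>M V (Suc ?n)) ?W fst = ?W"
    by (simp add: V.distr_pair_fst V.emeasure_space_1 scale_measure_1)
  finally have Xn: "nested_copula t z ?n = distr ?W borel (X ?n)" using Suc by (simp del: X.simps nested_copula.simps)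
  have "distr \<Omega> borel (X (Suc ?n)) = distr (?W \<Otimes>\<^sub>M V (Suc ?n)) borel (\<lambda>(\<omega>, x). tail_step (t ^ ?n) (X ?n \<omega>, x))"
    unfolding law[OF XO] X.simps(2)[of ?n] by (simp add: X_fun_upd del: X.simps)
  also have "\<dots> = distr (?W \<Otimes>\<^sub>M V (Suc ?n)) borel (tail_step (t ^ ?n) \<circ> (\<lambda>(\<omega>, x). (X ?n \<omega>, x)))"
    by (simp add: o_def split_beta' del: X.simps)
  also have "\<dots> = distr (distr (?W \<Otimes>\<^sub>M V (Suc ?n)) (borel \<Otimes>\<^sub>M V (Suc ?n)) (\<lambda>(\<omega>, x). (X ?n \<omega>, x))) borel (tail_step (t ^ ?n))"
    by (subst distr_distr) (simp_all del: X.simps)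
  also have "distr (?W \<Otimes>\<^sub>M V (Suc ?n)) (borel \<Otimes>\<^sub>M V (Suc ?n)) (\<lambda>(\<omega>, x). (X ?n \<omega>, x))
    = distr ?W borel (X ?n) \<Otimes>\<^sub>M distr (V (Suc ?n)) (V (Suc ?n)) (\<lambda>x. x)"
    by (rule pair_measure_distr[symmetric]) (simp_all add: distr_id V.sigma_finite_measure_axioms del: X.simps)
  also have "\<dots> = nested_copula t z ?n \<Otimes>\<^sub>M V (Suc ?n)"
    by (simp add: Xn distr_id del: X.simps nested_copula.simps)
  finally show ?case by simp
qed

definition limit_copula :: "(real^'r) measure" where "limit_copula = distr \<Omega> borel Xlim"

lemma measurable_Xlim [measurable]: "Xlim \<in> \<Omega> \<rightarrow>\<^sub>M borel"
proof -
  have [measurable]: "X n \<in> \<Omega> \<rightarrow>\<^sub>M borel" for n by (rule measurable_X) simp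
  have "(\<lambda>\<omega>. Xlim \<omega> $ i) \<in> \<Omega> \<rightarrow>\<^sub>M borel" for i
    by (rule borel_measurable_LIMSEQ_real[where u="\<lambda>n \<omega>. X n \<omega> $ i"]) (simp_all add: X_tendsto_nth)
  then have "(\<lambda>\<omega>. \<chi> i. Xlim \<omega> $ i) \<in> \<Omega> \<rightarrow>\<^sub>M borel" by (rule measurable_vec_lambda)
  then show ?thesis by simp
qed

lemma cube_prob_limit_copula: "cube_prob limit_copula"
proof -
  interpret prob_space \<Omega> by (rule prob_space_\<Omega>)
  have "prob_space limit_copula" unfolding limit_copula_def by (rule prob_space_distr) simp
  moreover have "emeasure limit_copula unit_cube = emeasure \<Omega> (space \<Omega>)"
    unfolding limit_copula_def by (subst emeasure_distr) (auto simp: Xlim_in_cube intro!: arg_cong[where f="emeasure \<Omega>"])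
  ultimately show ?thesis unfolding cube_prob_def using emeasure_space_1 by (simp add: limit_copula_def)
qed

lemma is_tnest_limit_limit_copula: "is_tnest_limit (\<lambda>n. vec t) z limit_copula"
  unfolding is_tnest_limit_def weak_limit_def
proof (intro conjI allI impI cube_prob_limit_copula)
  interpret prob_space \<Omega> by (rule prob_space_\<Omega>)
  fix f :: "real^'r \<Rightarrow> real"
  assume f: "continuous_on UNIV f" and "bounded (range f)"
  then obtain B where B: "\<bar>f x\<bar> \<le> B" for x by (auto simp: bounded_iff)
  have [measurable]: "f \<in> borel_measurable borel" using f by (rule borel_measurable_continuous_onI)
  have [measurable]: "X n \<in> \<Omega> \<rightarrow>\<^sub>M borel" for n by (rule measurable_X) simp
  have "(\<lambda>n. \<integral>\<omega>. f (X (Suc n) \<omega>) \<partial>\<Omega>) \<longlonglongrightarrow> (\<integral>\<omega>. f (Xlim \<omega>) \<partial>\<Omega>)"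
  proof (rule integral_dominated_convergence[where w="\<lambda>_. B"])
    have "(\<lambda>n. X n \<omega>) \<longlonglongrightarrow> Xlim \<omega>" for \<omega>
      by (rule vec_tendstoI) (rule X_tendsto_nth)
    then have "(\<lambda>n. X (Suc n) \<omega>) \<longlonglongrightarrow> Xlim \<omega>" for \<omega>
      by (rule LIMSEQ_Suc)
    then show "AE \<omega> in \<Omega>. (\<lambda>n. f (X (Suc n) \<omega>)) \<longlonglongrightarrow> f (Xlim \<omega>)"
      using f by (intro AE_I2 continuous_on_tendsto_compose[OF f]) auto
  qed (use B in \<open>auto simp del: X.simps\<close>)
  moreover have "integral\<^sup>L (fst (tnest_seq (\<lambda>n. vec t) z n)) f = (\<integral>\<omega>. f (X (Suc n) \<omega>) \<partial>\<Omega>)" for n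
    unfolding tnest_seq_eq fst_conv distr_X[symmetric] by (rule integral_distr) simp_all
  moreover have "integral\<^sup>L limit_copula f = (\<integral>\<omega>. f (Xlim \<omega>) \<partial>\<Omega>)"
    unfolding limit_copula_def by (rule integral_distr) simp_all
  ultimately show "(\<lambda>n. integral\<^sup>L (fst (tnest_seq (\<lambda>n. vec t) z n)) f) \<longlonglongrightarrow> integral\<^sup>L limit_copula f"
    by simp
qed

lemma limit_copula_orthant:
  assumes s: "t \<le> s" "s \<le> 1"
  shows "measure limit_copula (orthant \<nu> (t ^ n * s)) =
    (\<Prod>m\<in>{1..n}. \<Sum>\<eta> | \<eta> \<inter> \<nu> = {}. z m \<eta>) * measure (V (Suc n)) (orthant \<nu> s)"
proof -
  have XO [measurable]: "X (Suc n) \<in> \<Omega> \<rightarrow>\<^sub>M borel" by (rule measurable_X) simp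
  \<comment> \<open>Here \<open>t \<le> s\<close> enters: the level is not below the threshold of
    stage \<open>Suc n\<close>, so that stage decides it.\<close>
  have "t ^ Suc n \<le> t ^ n * s" using s t by (simp add: mult.commute)
  then have "Xlim -` orthant \<nu> (t ^ n * s) = X (Suc n) -` orthant \<nu> (t ^ n * s)"
    unfolding orthant_def by (simp add: Xlim_le_iff[of "Suc n"] vimage_def del: X.simps)
  then have "measure limit_copula (orthant \<nu> (t ^ n * s)) = measure (distr \<Omega> borel (X (Suc n))) (orthant \<nu> (t ^ n * s))"
    unfolding limit_copula_def by (simp add: measure_distr del: X.simps)
  then show ?thesis using s t by (simp add: distr_X nested_copula_Suc_orthant nested_copula_orthant del: nested_copula.simps)
qed

end

section \<open>Vertex copulas with prescribed corner masses\<close>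

text \<open>The recursive form of the Moebius inverse makes its sign visible: the subtracted terms are
  bounded by values of \<open>p\<close> at larger sets.\<close>

function superset_mobius :: "('r::finite set \<Rightarrow> real) \<Rightarrow> 'r set \<Rightarrow> real" where
  "superset_mobius p \<xi> = p \<xi> - (\<Sum>\<xi>'\<in>{\<xi>'. \<xi> \<subset> \<xi>'}. superset_mobius p \<xi>')"
  by auto
termination
  by (relation "Wellfounded.measure (\<lambda>(p, \<xi>). card (- \<xi>))") (auto intro!: psubset_card_mono)

declare superset_mobius.simps [simp del]

lemma sum_superset_mobius: "(\<Sum>\<xi>' | \<xi> \<subseteq> \<xi>'. superset_mobius p \<xi>') = p \<xi>"
proof -
  have "{\<xi>'. \<xi> \<subseteq> \<xi>'} = insert \<xi> {\<xi>'. \<xi> \<subset> \<xi>'}" by auto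
  then show ?thesis by (simp add: superset_mobius.simps[of p \<xi>])
qed

text \<open>Inductively from the top, the value at a proper superset \<open>\<xi>'\<close> lies
  between 0 and \<open>p \<xi>'\<close>, hence is at most \<open>p \<xi>\<close> divided by the
  number of all subsets. There are no more terms than that, so the subtracted sum is at most
  \<open>p \<xi>\<close>.\<close>

lemma superset_mobius_nonneg:
  fixes p :: "'r::finite set \<Rightarrow> real"
  assumes pos: "\<And>\<xi>. 0 \<le> p \<xi>" and dec: "\<And>\<xi> \<xi>'. \<xi> \<subset> \<xi>' \<Longrightarrow> 2 ^ CARD('r) * p \<xi>' \<le> p \<xi>"
  shows "0 \<le> superset_mobius p \<xi>"
proof (induction "card (- \<xi>)" arbitrary: \<xi> rule: less_induct)
  case less
  have IH: "0 \<le> superset_mobius p \<xi>'" if "\<xi> \<subset> \<xi>'" for \<xi>'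
    by (rule less) (use that in \<open>auto intro!: psubset_card_mono\<close>)
  have le: "superset_mobius p \<xi>' \<le> p \<xi> / 2 ^ CARD('r)" if "\<xi> \<subset> \<xi>'" for \<xi>'
  proof -
    have "superset_mobius p \<xi>' \<le> p \<xi>'"
      using IH that by (subst superset_mobius.simps) (auto intro!: sum_nonneg)
    also have "p \<xi>' \<le> p \<xi> / 2 ^ CARD('r)"
      using dec[OF that] by (simp add: field_simps)
    finally show ?thesis .
  qed
  have "(\<Sum>\<xi>' | \<xi> \<subset> \<xi>'. superset_mobius p \<xi>') \<le> of_nat (card {\<xi>'. \<xi> \<subset> \<xi>'}) * (p \<xi> / 2 ^ CARD('r))"
    by (rule sum_bounded_above) (use le in simp)
  also have "\<dots> \<le> 2 ^ CARD('r) * (p \<xi> / 2 ^ CARD('r))"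
  proof (rule mult_right_mono)
    have "card {\<xi>'. \<xi> \<subset> \<xi>'} \<le> card (UNIV :: 'r set set)" by (rule card_mono) auto
    also have "\<dots> = 2 ^ CARD('r)" by (simp add: card_UNIV_set)
    finally have "real (card {\<xi>'. \<xi> \<subset> \<xi>'}) \<le> real (2 ^ CARD('r))" by (rule of_nat_mono)
    then show "real (card {\<xi>'. \<xi> \<subset> \<xi>'}) \<le> 2 ^ CARD('r)" by simp
  qed (simp add: pos)
  finally show ?case by (subst superset_mobius.simps) simp
qed

text \<open>\<open>\<eta>\<close> is disjoint from \<open>\<nu>\<close> exactly when
  \<open>- \<eta>\<close> contains \<open>\<nu>\<close>, so corner masses become superset sums after
  complementation.\<close>

lemma ex_vertex_masses:
  fixes p :: "'r::finite set \<Rightarrow> real"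
  assumes "\<And>\<xi>. 0 \<le> p \<xi>" and "\<And>\<xi> \<xi>'. \<xi> \<subset> \<xi>' \<Longrightarrow> 2 ^ CARD('r) * p \<xi>' \<le> p \<xi>"
  shows "\<exists>z. (\<forall>\<eta>. 0 \<le> z \<eta>) \<and> (\<forall>\<nu>. (\<Sum>\<eta> | \<eta> \<inter> \<nu> = {}. z \<eta>) = p \<nu>)"
proof (intro exI[of _ "\<lambda>\<eta>. superset_mobius p (- \<eta>)"] conjI allI)
  show "0 \<le> superset_mobius p (- \<eta>)" for \<eta> by (rule superset_mobius_nonneg[OF assms])
  show "(\<Sum>\<eta> | \<eta> \<inter> \<nu> = {}. superset_mobius p (- \<eta>)) = p \<nu>" for \<nu>
    unfolding sum_superset_mobius[of p \<nu>, symmetric]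
    by (rule sum.reindex_bij_witness[where i=uminus and j=uminus]) auto
qed

text \<open>The sets disjoint from \<open>\<nu> - \<mu>\<close> have trace on \<open>\<nu>\<close>
  inside \<open>\<mu>\<close>, and by induction only the trace \<open>\<mu>\<close> itself can still
  contribute. Applied to a difference of masses, this shows that corner masses of subfaces determine
  the masses of the projected boxes.\<close>

lemma sum_trace_eq_0:
  fixes d :: "'r::finite set \<Rightarrow> real"
  assumes d: "\<And>\<rho>. \<rho> \<subseteq> \<nu> \<Longrightarrow> (\<Sum>\<eta> | \<eta> \<inter> \<rho> = {}. d \<eta>) = 0" and "\<mu> \<subseteq> \<nu>"
  shows "(\<Sum>\<eta> | \<eta> \<inter> \<nu> = \<mu>. d \<eta>) = 0"
  using finite[of \<mu>] \<open>\<mu> \<subseteq> \<nu>\<close>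
proof (induction \<mu> rule: finite_psubset_induct)
  case (psubset \<mu>)
  have "0 = (\<Sum>\<eta> | \<eta> \<inter> (\<nu> - \<mu>) = {}. d \<eta>)" by (subst d) auto
  also have "\<dots> = (\<Sum>\<mu>'\<in>Pow \<mu>. \<Sum>\<eta> | \<eta> \<in> {\<eta>. \<eta> \<inter> (\<nu> - \<mu>) = {}} \<and> \<eta> \<inter> \<nu> = \<mu>'. d \<eta>)"
    by (rule sum.group[symmetric]) auto
  also have "\<dots> = (\<Sum>\<mu>'\<in>Pow \<mu>. \<Sum>\<eta> | \<eta> \<inter> \<nu> = \<mu>'. d \<eta>)"
    using psubset.prems by (intro sum.cong refl arg_cong2[where f=sum]) auto
  also have "\<dots> = (\<Sum>\<mu>'\<in>{\<mu>}. \<Sum>\<eta> | \<eta> \<inter> \<nu> = \<mu>'. d \<eta>)"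
    using psubset by (intro sum.mono_neutral_right) auto
  finally show ?case by simp
qed

lemma measure_cube_unif_orthant:
  fixes \<nu> :: "'r::finite set"
  assumes s: "0 \<le> s" "s \<le> 1"
  shows "measure cube_unif (orthant \<nu> s) = s ^ card \<nu>"
proof -
  have 1: "emeasure lborel (unit_cube :: (real^'r) set) = 1"
    by (simp add: unit_cube_def emeasure_lborel_cbox_cart)
  have "unit_cube \<inter> orthant \<nu> s = cbox 0 (\<chi> i. if i \<in> \<nu> then s else 1)"
    using s by (auto simp: unit_cube_def orthant_def mem_box_cart split: if_splits) (metis order.trans)
  then have "emeasure cube_unif (orthant \<nu> s) = (\<Prod>i\<in>UNIV. if i \<in> \<nu> then ennreal s else 1)"
    using s by (simp add: 1 emeasure_lborel_cbox_cart divide_ennreal_def) (auto intro!: prod.cong)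
  also have "\<dots> = ennreal (s ^ card \<nu>)"
    using s by (simp add: prod.If_cases ennreal_power)
  finally show ?thesis using s by (simp add: measure_def)
qed

text \<open>The uniform distribution is itself a vertex measure, with the box volumes as masses; it
  is the reference in \<open>face_marginal_vertex_measure\<close>.\<close>

lemma emeasure_cube_unif_vertex_boxes:
  fixes A :: "(real^'r::finite) set"
  assumes t: "0 < t" "t < 1" and A: "A \<in> sets borel"
  shows "emeasure cube_unif A =
    (\<Sum>\<eta>\<in>UNIV. emeasure cube_unif (vertex_box (vec t) \<eta>) * emeasure (uniform_measure lborel (vertex_box (vec t) \<eta>)) A)"
proof -
  \<comment> \<open>The trivial grid, split once, consists exactly of the vertex boxes.\<close>
  let ?P = "{(0 :: real^'r, 1)}"
  have P: "tail_pairs (t * 1) (split_pairs t ?P)"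
    by (rule tail_pairs_split[OF _ t]) (auto simp: tail_pairs_def unit_cube_def)
  have "box_aff 0 1 x = x" for x :: "real^'r" by (simp add: box_aff_def vec_eq_iff)
  moreover have "?P \<times> (UNIV :: 'r set set) = range (Pair (0 :: real^'r, 1 :: real^'r)) " by auto
  ultimately have sp: "split_pairs t ?P = (\<lambda>\<eta>. (vlo t \<eta>, vhi t \<eta>)) ` UNIV"
    by (simp add: split_pairs_def image_image)
  have inj: "inj (\<lambda>\<eta> :: 'r set. (vlo t \<eta>, vhi t \<eta>))"
    using t by (auto simp: inj_on_def vlo_def vec_eq_iff split: if_splits)
  have "grid_uniform (uniform_measure lborel (cbox 0 (1 :: real^'r))) (boxes (split_pairs t ?P))"
  proof (rule uniform_box_grid[OF P])
    fix l h :: "real^'r" assume "(l, h) \<in> split_pairs t ?P"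
    then have "cbox l h \<subseteq> cbox 0 1"
      using tail_pairsD[OF P] by (intro subset_interval_imp_cart(1)) auto
    then show "cbox l h \<subseteq> cbox 0 1 \<or> (\<exists>i. h$i \<le> (0 :: real^'r) $ i \<or> (1 :: real^'r) $ i \<le> l$i)" ..
  qed (simp_all add: unit_cube_def)
  then show ?thesis
    using A unfolding grid_uniform_def sum_boxes[OF P] unfolding unit_cube_def[symmetric] sp
    by (simp add: sum.reindex[OF inj] o_def vertex_box_eq del: emeasure_uniform_measure)
qed

lemma face_proj_compl:
  "face_proj (compl_face (front_face \<nu>)) u = (\<chi> i. if i \<in> \<nu> then u$i else 0)"
  by (auto simp: vec_eq_iff)

text \<open>Boxes with the same trace on \<open>\<nu>\<close> project to the same law, so the
  marginal depends on the masses only through trace sums. On subsets of \<open>\<nu>\<close> the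
  corner masses agree with those of the uniform distribution; hence so do the trace sums.\<close>

lemma face_marginal_vertex_measure:
  fixes \<nu> :: "'r::finite set"
  assumes t: "0 < t" "t < 1" and z: "\<And>\<eta>. 0 \<le> z \<eta>"
    and p: "\<And>\<rho>. \<rho> \<subseteq> \<nu> \<Longrightarrow> (\<Sum>\<eta> | \<eta> \<inter> \<rho> = {}. z \<eta>) = t ^ card \<rho>"
  shows "face_marginal (front_face \<nu>) (vertex_measure (vec t) z) = face_uniform (front_face \<nu>)"
proof -
  interpret U: prob_space "cube_unif :: (real^'r) measure" by (rule prob_space_cube_unif)
  define \<pi> where "\<pi> = face_proj (compl_face (front_face \<nu>))"
  have m\<pi> [measurable]: "\<pi> \<in> borel_measurable borel" unfolding \<pi>_def by simp
  define z0 where "z0 = (\<lambda>\<eta>. measure cube_unif (vertex_box (vec t) \<eta> :: (real^'r) set))"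
  have z0: "0 \<le> z0 \<eta>" for \<eta> by (simp add: z0_def)
  have vm0: "emeasure (vertex_measure (vec t) z0) A = emeasure cube_unif A" if "A \<in> sets borel" for A
    using that unfolding emeasure_vertex_measure[OF t z0 that] emeasure_cube_unif_vertex_boxes[OF t that]
    by (simp add: z0_def U.emeasure_eq_measure del: emeasure_uniform_measure)
  have p0: "(\<Sum>\<eta> | \<eta> \<inter> \<rho> = {}. z0 \<eta>) = t ^ card \<rho>" for \<rho>
  proof -
    have "measure (vertex_measure (vec t) z0) (orthant \<rho> t) = measure cube_unif (orthant \<rho> t)"
      by (simp add: measure_def vm0 del: emeasure_uniform_measure)
    then show ?thesis
      using t by (simp add: measure_vertex_measure_orthant[OF t z0] measure_cube_unif_orthant)
  qed
  have q: "(\<Sum>\<eta> | \<eta> \<inter> \<nu> = \<mu>. z \<eta>) = (\<Sum>\<eta> | \<eta> \<inter> \<nu> = \<mu>. z0 \<eta>)" if "\<mu> \<subseteq> \<nu>" for \<mu>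
    using sum_trace_eq_0[of \<nu> "\<lambda>\<eta>. z \<eta> - z0 \<eta>" \<mu>] that by (simp add: sum_subtractf p p0)
  define g where "g \<eta> A = measure (distr (uniform_measure lborel (vertex_box (vec t) \<eta>)) borel \<pi>) A" for \<eta> A
  have g_trace: "g \<eta> A = g (\<eta> \<inter> \<nu>) A" for \<eta> A
  proof -
    have "distr (uniform_measure lborel (vertex_box (vec t) \<eta>)) borel \<pi> = distr cube_unif borel (\<pi> \<circ> box_aff (vlo t \<eta>) (vhi t \<eta>))" for \<eta>
      unfolding vertex_box_eq distr_cube_unif_box_aff[OF vlo_less_vhi[OF t], symmetric]
      by (rule distr_distr) simp_all
    moreover have "\<pi> \<circ> box_aff (vlo t \<eta>) (vhi t \<eta>) = \<pi> \<circ> box_aff (vlo t (\<eta> \<inter> \<nu>)) (vhi t (\<eta> \<inter> \<nu>))"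
      unfolding \<pi>_def by (auto simp: fun_eq_iff vec_eq_iff box_aff_def vlo_def vhi_def)
    ultimately show ?thesis by (simp add: g_def)
  qed
  have push: "emeasure (distr (vertex_measure (vec t) w) borel \<pi>) A = ennreal (\<Sum>\<mu>\<in>Pow \<nu>. (\<Sum>\<eta> | \<eta> \<inter> \<nu> = \<mu>. w \<eta>) * g \<mu> A)"
    if w: "\<And>\<eta>. 0 \<le> w \<eta>" and A: "A \<in> sets borel" for w A
  proof -
    have B: "\<pi> -` A \<in> sets borel" using measurable_sets[OF m\<pi> A] by simp
    have gg: "emeasure (uniform_measure lborel (vertex_box (vec t) \<eta>)) (\<pi> -` A) = ennreal (g \<eta> A)" for \<eta>
    proof -
      interpret prob_space "uniform_measure lborel (vertex_box (vec t) \<eta>)" by (rule prob_space_uniform_vertex_box[OF t])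
      show ?thesis unfolding emeasure_eq_measure g_def by (subst measure_distr) (use A in auto)
    qed
    have "space (vertex_measure (vec t) w) = UNIV" by (simp add: vertex_measure_def)
    then have "emeasure (distr (vertex_measure (vec t) w) borel \<pi>) A = emeasure (vertex_measure (vec t) w) (\<pi> -` A)"
      by (subst emeasure_distr) (use A in auto)
    also have "\<dots> = ennreal (\<Sum>\<eta>\<in>UNIV. w \<eta> * g \<eta> A)"
      unfolding emeasure_vertex_measure[OF t w B] gg using w
      by (simp add: ennreal_mult[symmetric] g_def sum_ennreal)
    also have "(\<Sum>\<eta>\<in>UNIV. w \<eta> * g \<eta> A) = (\<Sum>\<mu>\<in>Pow \<nu>. \<Sum>\<eta> | \<eta> \<in> UNIV \<and> \<eta> \<inter> \<nu> = \<mu>. w \<eta> * g \<eta> A)"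
      by (rule sum.group[symmetric]) auto
    also have "\<dots> = (\<Sum>\<mu>\<in>Pow \<nu>. (\<Sum>\<eta> | \<eta> \<inter> \<nu> = \<mu>. w \<eta>) * g \<mu> A)"
      unfolding sum_distrib_right by (intro sum.cong) (use g_trace in auto)
    finally show ?thesis .
  qed
  have "distr (vertex_measure (vec t) z) borel \<pi> = distr cube_unif borel \<pi>"
  proof (rule measure_eqI)
    fix A assume "A \<in> sets (distr (vertex_measure (vec t) z) borel \<pi>)"
    then have A: "A \<in> sets borel" by simp
    have B: "\<pi> -` A \<in> sets borel" using measurable_sets[OF m\<pi> A] by simp
    have "space (vertex_measure (vec t) z0) = UNIV" by (simp add: vertex_measure_def)
    then have "emeasure (distr cube_unif borel \<pi>) A = emeasure (distr (vertex_measure (vec t) z0) borel \<pi>) A"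
      using A B by (subst (1 2) emeasure_distr) (simp_all add: vm0 del: emeasure_uniform_measure)
    then show "emeasure (distr (vertex_measure (vec t) z) borel \<pi>) A = emeasure (distr cube_unif borel \<pi>) A"
      by (simp add: push[OF z A] push[OF z0 A] q)
  qed simp
  then show ?thesis
    by (simp add: face_marginal_def push_along_def face_uniform_def \<pi>_def)
qed

section \<open>Corner masses of face marginals and membership in the vertex copulas\<close>

lemma measure_face_marginal_orthant:
  assumes sc: "sets c = sets borel"
  shows "measure (face_marginal (front_face \<nu>) c) (orthant \<nu> s) = measure c (orthant \<nu> s)"
proof -
  note [measurable_cong] = sc
  have "face_proj (compl_face (front_face \<nu>)) -` orthant \<nu> s \<inter> space c = orthant \<nu> s"
    unfolding orthant_def using sets_eq_imp_space_eq[OF sc] by (auto simp: face_proj_compl simp del: compl_front_face)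
  moreover have "face_proj (compl_face (front_face \<nu>)) \<in> c \<rightarrow>\<^sub>M borel" by measurable
  ultimately show ?thesis
    unfolding face_marginal_def push_along_def by (subst measure_distr) (simp_all del: compl_front_face)
qed

text \<open>A condition at level \<open>t\<close> fixes the corner mass at every level because the
  marginal on the face is uniform. This makes the profile a pure power on low-dimensional
  faces.\<close>

lemma vertex_measure_orthant_power:
  fixes \<nu> :: "'r::finite set"
  assumes t: "0 < t" "t < 1" and z: "\<And>\<eta>. 0 \<le> z \<eta>"
    and p: "\<And>\<rho>. \<rho> \<subseteq> \<nu> \<Longrightarrow> (\<Sum>\<eta> | \<eta> \<inter> \<rho> = {}. z \<eta>) = t ^ card \<rho>"
    and s: "0 \<le> s" "s \<le> 1"
  shows "measure (vertex_measure (vec t) z) (orthant \<nu> s) = s ^ card \<nu>"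
proof -
  have "measure (vertex_measure (vec t) z) (orthant \<nu> s) = measure (face_marginal (front_face \<nu>) (vertex_measure (vec t) z)) (orthant \<nu> s)"
    by (simp add: measure_face_marginal_orthant)
  also have "\<dots> = measure (face_marginal (front_face \<nu>) cube_unif) (orthant \<nu> s)"
    by (simp only: face_marginal_vertex_measure[OF t z p] face_uniform_def)
  also have "\<dots> = measure cube_unif (orthant \<nu> s)"
    by (rule measure_face_marginal_orthant) simp
  finally show ?thesis by (simp add: measure_cube_unif_orthant[OF s])
qed

lemma vertex_copulasI:
  fixes z :: "'r::finite vertex \<Rightarrow> real"
  assumes t: "0 < t" "t < 1" and z: "\<And>\<eta>. 0 \<le> z \<eta>"
    and p: "\<And>\<rho>. card \<rho> \<le> k \<Longrightarrow> (\<Sum>\<eta> | \<eta> \<inter> \<rho> = {}. z \<eta>) = t ^ card \<rho>"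
  shows "z \<in> vertex_copulas k (vec t)"
proof -
  have sum: "(\<Sum>\<eta>\<in>UNIV. z \<eta>) = 1" using p[of "{}"] by simp
  have "z \<eta> \<le> (\<Sum>\<eta>\<in>UNIV. z \<eta>)" for \<eta> by (rule member_le_sum) (use z in auto)
  then have "z \<eta> \<in> {0..1}" for \<eta> using z sum by simp
  moreover have "face_marginal F (vertex_measure (vec t) z) = face_uniform F"
    if F: "F \<in> front_faces" "dim F = k" for F
  proof -
    obtain \<nu> where \<nu>: "F = front_face \<nu>" using F by (auto simp: front_faces_def)
    have "card \<rho> \<le> k" if "\<rho> \<subseteq> \<nu>" for \<rho>
      using that F(2) card_mono[OF finite that] by (simp add: \<nu>)
    then show ?thesis unfolding \<nu> by (intro face_marginal_vertex_measure[OF t z p])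
  qed
  ultimately show ?thesis
    unfolding vertex_copulas_def copula_of_order_def using cube_prob_vertex_measure[OF t z sum] by simp
qed

text \<open>The scaled face is a degenerate box, and its preimage under the projection asks for
  coordinates between 0 and \<open>s\<close> on \<open>\<nu>\<close>. The lower bounds hold almost
  surely, since the measure lives on the cube.\<close>

lemma measure_face_marginal_scaled_face:
  assumes c: "cube_prob c" and s: "0 < s"
  shows "measure (face_marginal (front_face \<nu>) c) ((\<lambda>u. s *\<^sub>R u) ` front_face \<nu>) = measure c (orthant \<nu> s)"
proof -
  interpret prob_space c using c by (simp add: cube_prob_def)
  have sc [measurable_cong]: "sets c = sets borel" using c by (simp add: cube_prob_def)
  have spc: "space c = UNIV" using sets_eq_imp_space_eq[OF sc] by simp
  let ?C = "cbox 0 (\<chi> i. if i \<in> \<nu> then s else 0)"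
  let ?\<pi> = "face_proj (compl_face (front_face \<nu>))"
  have "(\<lambda>u. s *\<^sub>R u) ` front_face \<nu> = ?C"
  proof (intro equalityI subsetI)
    fix y assume y: "y \<in> ?C"
    have "y = s *\<^sub>R (inverse s *\<^sub>R y)" using s by simp
    moreover have "inverse s *\<^sub>R y \<in> front_face \<nu>"
      using y s by (auto simp: front_face_def unit_cube_def mem_box_cart field_simps split: if_splits)
    ultimately show "y \<in> (\<lambda>u. s *\<^sub>R u) ` front_face \<nu>" by blast
  next
    fix y assume "y \<in> (\<lambda>u. s *\<^sub>R u) ` front_face \<nu>"
    then show "y \<in> ?C" using s by (auto simp: front_face_def unit_cube_def mem_box_cart)
  qed
  moreover have "?\<pi> \<in> c \<rightarrow>\<^sub>M borel" by measurable
  ultimately have "measure (face_marginal (front_face \<nu>) c) ((\<lambda>u. s *\<^sub>R u) ` front_face \<nu>) = measure c (?\<pi> -` ?C)"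
    unfolding face_marginal_def push_along_def by (subst measure_distr) (simp_all add: spc del: compl_front_face)
  also have "\<dots> = measure c (orthant \<nu> s)"
  proof (rule finite_measure_eq_AE)
    show "AE x in c. x \<in> ?\<pi> -` ?C \<longleftrightarrow> x \<in> orthant \<nu> s"
      using AE_cube_prob[OF c] by eventually_elim
        (auto simp: face_proj_compl orthant_def unit_cube_def mem_box_cart simp del: compl_front_face)
    show "?\<pi> -` ?C \<in> sets c" using measurable_sets[OF \<open>?\<pi> \<in> c \<rightarrow>\<^sub>M borel\<close>, of ?C] by (simp add: spc del: compl_front_face)
    show "orthant \<nu> s \<in> sets c" by (simp add: sc)
  qed
  finally show ?thesis .
qed

section \<open>Tail characteristics\<close>

lemma ex_scale:
  fixes t s :: real
  assumes t: "0 < t" "t < 1" and s: "0 < s" "s < t ^ N"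
  obtains n s' where "N \<le> n" "t \<le> s'" "s' \<le> 1" "s = t ^ n * s'"
proof -
  obtain n0 where "t ^ n0 < s" using real_arch_pow_inv[OF s(1) t(2)] by blast
  moreover have "t ^ Suc n0 \<le> t ^ n0" using t by (intro power_decreasing) auto
  ultimately have ex: "t ^ Suc n0 \<le> s" by linarith
  \<comment> \<open>Minimality gives the other inequality, \<open>s \<le> t ^ n\<close>.\<close>
  define n where "n = (LEAST n. t ^ Suc n \<le> s)"
  have n: "t ^ Suc n \<le> s" unfolding n_def using ex by (rule LeastI)
  have "s \<le> t ^ n"
  proof (cases n)
    case 0
    have "t ^ N \<le> 1" using t by (simp add: power_le_one)
    then show ?thesis using 0 s by simp
  next
    case (Suc m)
    then have "\<not> t ^ Suc m \<le> s" using not_less_Least[of m "\<lambda>n. t ^ Suc n \<le> s"] by (simp add: n_def)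
    then show ?thesis using Suc by simp
  qed
  have "N \<le> n"
  proof (rule ccontr)
    assume "\<not> N \<le> n"
    then have "t ^ N \<le> t ^ Suc n" using t by (intro power_decreasing) auto
    then show False using n s by simp
  qed
  moreover have "t \<le> s / t ^ n" "s / t ^ n \<le> 1" using n \<open>s \<le> t ^ n\<close> t by (simp_all add: field_simps)
  moreover have "s = t ^ n * (s / t ^ n)" using t by simp
  ultimately show ?thesis by (rule that)
qed

text \<open>Infimum, over one multiplicative period, of the ratio whose lower limit at 0 is the tail
  coefficient.\<close>

definition profile_inf :: "(real \<Rightarrow> real) \<Rightarrow> real \<Rightarrow> real \<Rightarrow> real" where
  "profile_inf P t b = (INF s\<in>{t..1}. P s / s powr b)"

context
  fixes P :: "real \<Rightarrow> real" and t b :: real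
  assumes t: "0 < t" "t < 1" and b: "0 \<le> b"
    and P: "\<And>s. t \<le> s \<Longrightarrow> s \<le> 1 \<Longrightarrow> t powr b \<le> P s \<and> P s \<le> 1"
begin

lemma profile_ge:
  assumes "t \<le> s" "s \<le> 1"
  shows "t powr b \<le> P s / s powr b"
proof -
  have "s powr b \<le> 1" using assms t b by (intro powr_le1) auto
  moreover have "0 < s powr b" using assms t by simp
  ultimately have "t powr b * s powr b \<le> t powr b * 1" by (intro mult_left_mono) auto
  with P[OF assms] \<open>0 < s powr b\<close> show ?thesis by (simp add: le_divide_eq)
qed

lemma profile_inf_pos: "0 < profile_inf P t b"
proof -
  have "t powr b \<le> profile_inf P t b"
    unfolding profile_inf_def using t by (intro cINF_greatest) (auto intro: profile_ge)
  then show ?thesis using t by (smt (verit) powr_gt_zero)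
qed

lemma profile_inf_le:
  assumes "t \<le> s" "s \<le> 1"
  shows "profile_inf P t b \<le> P s / s powr b"
  unfolding profile_inf_def
proof (rule cINF_lower)
  show "bdd_below ((\<lambda>s. P s / s powr b) ` {t..1})"
    by (rule bdd_belowI2[of _ "t powr b"]) (auto intro: profile_ge)
qed (use assms in auto)

context
  fixes m :: "real \<Rightarrow> real" and A :: real and N :: nat
  assumes A: "0 < A"
    and m: "\<And>n s. N \<le> n \<Longrightarrow> t \<le> s \<Longrightarrow> s \<le> 1 \<Longrightarrow> m (t ^ n * s) = A * (t ^ n) powr b * P s"
begin

text \<open>The right-hand side is free of \<open>n\<close>: below \<open>t ^ N\<close> the ratio
  repeats itself from one period to the next.\<close>

lemma ratio_eq:
  assumes "N \<le> n" "t \<le> s" "s \<le> 1"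
  shows "m (t ^ n * s) / (t ^ n * s) powr b = A * (P s / s powr b)"
  using assms t by (simp add: m powr_mult)

lemma eventually_ratio:
  "eventually (\<lambda>s. 0 < s \<and> s < 1 \<and> A * profile_inf P t b \<le> m s / s powr b \<and> m s / s powr b \<le> A / t powr b) (at_right 0)"
  unfolding eventually_at_right_field
proof (intro exI[of _ "t ^ N"] conjI allI impI)
  show "0 < t ^ N" using t by simp
  fix s :: real assume s: "0 < s" "s < t ^ N"
  show "0 < s" by fact
  have "t ^ N \<le> 1" using t by (simp add: power_le_one)
  then show "s < 1" using s by simp
  obtain n s' where n: "N \<le> n" "t \<le> s'" "s' \<le> 1" "s = t ^ n * s'" by (rule ex_scale[OF t s])
  have "m s / s powr b = A * (P s' / s' powr b)" using ratio_eq[OF n(1-3)] n(4) by simp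
  moreover have "A * profile_inf P t b \<le> A * (P s' / s' powr b)"
    using profile_inf_le[OF n(2,3)] A by (intro mult_left_mono) auto
  moreover have "A * (P s' / s' powr b) \<le> A * (1 / t powr b)"
  proof (intro mult_left_mono frac_le)
    show "t powr b \<le> s' powr b" using n t b by (intro powr_mono2) auto
  qed (use P[OF n(2,3)] t A in auto)
  ultimately show "A * profile_inf P t b \<le> m s / s powr b" "m s / s powr b \<le> A / t powr b" by simp_all
qed

text \<open>The lower bound holds on every period. Conversely, a ratio close to the infimum, taken
  at some \<open>s\<close> in [t,1], recurs at \<open>t ^ n * s\<close> for all large
  \<open>n\<close>, hence arbitrarily close to 0.\<close>

lemma Liminf_ratio: "Liminf (at_right 0) (\<lambda>s. ereal (m s / s powr b)) = ereal (A * profile_inf P t b)"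
proof (rule antisym)
  show "ereal (A * profile_inf P t b) \<le> Liminf (at_right 0) (\<lambda>s. ereal (m s / s powr b))"
    using eventually_ratio by (intro Liminf_bounded) (auto elim: eventually_mono)
  show "Liminf (at_right 0) (\<lambda>s. ereal (m s / s powr b)) \<le> ereal (A * profile_inf P t b)"
  proof (rule ccontr)
    assume "\<not> ?thesis"
    then have "ereal (A * profile_inf P t b) < Liminf (at_right 0) (\<lambda>s. ereal (m s / s powr b))" by simp
    then obtain y where y: "A * profile_inf P t b < y" "ereal y < Liminf (at_right 0) (\<lambda>s. ereal (m s / s powr b))"
      using ereal_dense2 by force
    have ev: "eventually (\<lambda>s. y < m s / s powr b) (at_right 0)"
      using less_LiminfD[OF y(2)] by simp
    have "profile_inf P t b < y / A" using y(1) A by (simp add: field_simps)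
    then obtain s where s: "t \<le> s" "s \<le> 1" and less: "P s / s powr b < y / A"
      unfolding profile_inf_def using t by (subst (asm) cINF_less_iff)
        (auto intro!: bdd_belowI2[of _ "t powr b"] profile_ge)
    have "(\<lambda>n. t ^ n * s) \<longlonglongrightarrow> 0 * s"
      using t by (intro tendsto_intros LIMSEQ_realpow_zero) auto
    then have "filterlim (\<lambda>n. t ^ n * s) (at_right 0) sequentially"
      using t s by (auto simp: filterlim_at intro!: always_eventually mult_pos_pos)
    from eventually_compose_filterlim[OF ev this] eventually_ge_at_top[of N]
    have "eventually (\<lambda>n. False) sequentially"
    proof eventually_elim
      case (elim n)
      then have "y < A * (P s / s powr b)" using ratio_eq[OF elim(2) s] by simp
      moreover have "A * (P s / s powr b) < A * (y / A)" using less A by (intro mult_strict_left_mono)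
      ultimately show False using A by simp
    qed
    then show False by simp
  qed
qed

text \<open>At exponent \<open>b\<close> the ratio stays between positive constants. An exponent
  beyond \<open>b\<close> multiplies it by a negative power of \<open>s\<close>, which tends to
  infinity; an exponent up to \<open>b\<close> keeps it bounded.\<close>

lemma Liminf_ratio_infinite_iff: "Liminf (at_right 0) (\<lambda>s. ereal (m s / s powr \<tau>)) = \<infinity> \<longleftrightarrow> b < \<tau>"
proof
  assume "b < \<tau>"
  define d where "d = \<tau> - b"
  have d: "0 < d" using \<open>b < \<tau>\<close> by (simp add: d_def)
  have C: "0 < A * profile_inf P t b" using A profile_inf_pos by simp
  show "Liminf (at_right 0) (\<lambda>s. ereal (m s / s powr \<tau>)) = \<infinity>"
  proof (rule ereal_top)
    fix B :: real
    \<comment> \<open>Chosen so that \<open>s < e\<close> forces \<open>s powr d \<le> D\<close> and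
      with it a ratio of at least \<open>\<bar>B\<bar> + 1\<close>; the summand 1 keeps the
      denominator positive.\<close>
    define D where "D = A * profile_inf P t b / (\<bar>B\<bar> + 1)"
    define e where "e = D powr (1 / d)"
    have D: "0 < D" unfolding D_def using C by (intro divide_pos_pos) auto
    then have e: "0 < e" by (simp add: e_def)
    have "eventually (\<lambda>s. 0 < s \<and> s < e) (at_right 0)"
      unfolding eventually_at_right_field using e by auto
    then have "eventually (\<lambda>s. ereal B \<le> ereal (m s / s powr \<tau>)) (at_right 0)"
      using eventually_ratio
    proof eventually_elim
      case (elim s)
      have "s powr d \<le> e powr d" using elim d by (intro powr_mono2) auto
      also have "\<dots> = D" using d D by (simp add: e_def powr_powr)
      finally have "(\<bar>B\<bar> + 1) * s powr d \<le> A * profile_inf P t b"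
        unfolding D_def by (subst (asm) pos_le_divide_eq) (auto simp: mult.commute)
      then have "\<bar>B\<bar> + 1 \<le> A * profile_inf P t b / s powr d"
        using elim by (subst pos_le_divide_eq) auto
      also have "\<dots> \<le> m s / s powr b / s powr d"
        using elim by (intro divide_right_mono) auto
      also have "\<dots> = m s / s powr \<tau>"
        by (simp add: d_def powr_add[symmetric])
      finally show ?case by simp
    qed
    then show "ereal B \<le> Liminf (at_right 0) (\<lambda>s. ereal (m s / s powr \<tau>))" by (rule Liminf_bounded)
  qed
next
  assume inf: "Liminf (at_right 0) (\<lambda>s. ereal (m s / s powr \<tau>)) = \<infinity>"
  show "b < \<tau>"
  proof (rule ccontr)
    assume "\<not> b < \<tau>"
    have "eventually (\<lambda>s. ereal (m s / s powr \<tau>) \<le> ereal (A / t powr b)) (at_right 0)"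
      using eventually_ratio
    proof eventually_elim
      case (elim s)
      have "0 < A * profile_inf P t b" using A profile_inf_pos by simp
      then have m0: "0 \<le> m s / s powr b" using elim by linarith
      have "m s / s powr \<tau> = m s / s powr b * s powr (b - \<tau>)"
        using elim by (simp add: powr_diff)
      also have "\<dots> \<le> m s / s powr b * 1"
        using elim \<open>\<not> b < \<tau>\<close> m0 by (intro mult_left_mono powr_le1) auto
      finally show ?case using elim by simp
    qed
    then have "Limsup (at_right 0) (\<lambda>s. ereal (m s / s powr \<tau>)) \<le> ereal (A / t powr b)" by (rule Limsup_bounded)
    moreover have "Liminf (at_right 0) (\<lambda>s. ereal (m s / s powr \<tau>)) \<le> Limsup (at_right 0) (\<lambda>s. ereal (m s / s powr \<tau>))"
      by (rule Liminf_le_Limsup) simp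
    ultimately show False using inf by simp
  qed
qed

end

end

lemma INF_greaterThan_ereal: "(INF \<tau>\<in>{b<..}. ereal \<tau>) = ereal b"
proof (rule antisym)
  show "(INF \<tau>\<in>{b<..}. ereal \<tau>) \<le> ereal b"
  proof (rule dense_ge)
    fix x assume "ereal b < x"
    then obtain e where "ereal b < ereal e" "ereal e < x" using ereal_dense2 by blast
    then show "(INF \<tau>\<in>{b<..}. ereal \<tau>) \<le> x" by (intro INF_lower2[of e]) auto
  qed
qed (auto intro!: INF_greatest)

text \<open>\<open>A\<close> stands for the constant accumulated before the vertex copulas become
  stationary, \<open>P\<close> for the profile of the stationary one.\<close>

lemma tchar_eqI:
  fixes c :: "(real^'r::finite) measure"
  assumes c: "cube_prob c" and t: "0 < t" "t < 1" and b: "0 \<le> b" and A: "0 < A"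
    and m: "\<And>n s. N \<le> n \<Longrightarrow> t \<le> s \<Longrightarrow> s \<le> 1 \<Longrightarrow> measure c (orthant \<nu> (t ^ n * s)) = A * (t ^ n) powr b * P s"
    and P: "\<And>s. t \<le> s \<Longrightarrow> s \<le> 1 \<Longrightarrow> t powr b \<le> P s \<and> P s \<le> 1"
  shows "tchar c (front_face \<nu>) = (ereal (A * profile_inf P t b), ereal b)"
proof -
  have tl: "tail_liminf c (front_face \<nu>) \<tau> = Liminf (at_right 0) (\<lambda>s. ereal (measure c (orthant \<nu> s) / s powr \<tau>))" for \<tau>
    unfolding tail_liminf_def
    by (intro Liminf_eq) (auto simp: eventually_at_right_field measure_face_marginal_scaled_face[OF c] intro!: exI[of _ 1])
  have "{\<tau>. tail_liminf c (front_face \<nu>) \<tau> = \<infinity>} = {b<..}"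
    unfolding tl using Liminf_ratio_infinite_iff[OF t b P A m] by auto
  then have "tdeg c (front_face \<nu>) = ereal b"
    by (simp add: tdeg_def INF_greaterThan_ereal)
  moreover have "tail_liminf c (front_face \<nu>) b = ereal (A * profile_inf P t b)"
    unfolding tl by (rule Liminf_ratio[OF t b P A m])
  ultimately show ?thesis by (simp add: tchar_def tcoef_def)
qed

section \<open>The construction for increasing \<open>b\<close>\<close>

lemma front_face_subset_iff: "front_face \<nu> \<subseteq> front_face \<nu>' \<longleftrightarrow> \<nu> \<subseteq> \<nu>'"
proof
  assume "front_face \<nu> \<subseteq> front_face \<nu>'"
  then have "face_vertex (front_face \<nu>) \<subseteq> face_vertex (front_face \<nu>')"
    unfolding face_vertex_def by auto
  then show "\<nu> \<subseteq> \<nu>'" by simp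
qed (auto simp: front_face_def)

lemma front_face_psubset_iff: "front_face \<nu> \<subset> front_face \<nu>' \<longleftrightarrow> \<nu> \<subset> \<nu>'"
  by (metis face_vertex_front_face front_face_subset_iff psubset_eq)

theorem corollary7p4:
  fixes k :: nat
    and a b :: "(real^'r::finite) set \<Rightarrow> real"
  assumes "1 \<le> k" and "k \<le> CARD('r)"
    and "\<forall>F\<in>front_faces. a F > 0"
    and "\<forall>F\<in>front_faces. b F \<ge> 0"
    and "NC k a b"
    and "increasing_on_faces b"
  shows "\<exists>(t::real) (z :: nat \<Rightarrow> 'r vertex \<Rightarrow> real) c.
    t \<in> {0<..<1} \<and>
    (\<forall>n\<ge>1. z n \<in> vertex_copulas k (vec t)) \<and>
    is_tnest_limit (\<lambda>n. vec t) z c \<and>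
    (\<forall>F\<in>front_faces. tchar c F = (ereal (a F), ereal (b F)))"
proof -
  define \<alpha> where "\<alpha> \<nu> = a (front_face \<nu>)" for \<nu> :: "'r set"
  define \<beta> where "\<beta> \<nu> = b (front_face \<nu>)" for \<nu> :: "'r set"
  have \<alpha>: "0 < \<alpha> \<nu>" and \<beta>: "0 \<le> \<beta> \<nu>" for \<nu>
    using assms(3,4) by (auto simp: \<alpha>_def \<beta>_def front_faces_def)
  have low: "\<alpha> \<nu> = 1" "\<beta> \<nu> = card \<nu>" if "card \<nu> \<le> k" for \<nu>
    using assms(5) that by (auto simp: NC_def \<alpha>_def \<beta>_def front_faces_def)
  have inc: "\<beta> \<nu> < \<beta> \<nu>'" if "\<nu> \<subset> \<nu>'" for \<nu> \<nu>'
    using assms(6) that by (auto simp: increasing_on_faces_def \<beta>_def front_faces_def front_face_psubset_iff)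

  obtain \<delta> where \<delta>: "0 < \<delta>" and gap: "\<And>\<nu> \<nu>'. \<nu> \<subset> \<nu>' \<Longrightarrow> \<beta> \<nu> + \<delta> \<le> \<beta> \<nu>'"
  proof -
    \<comment> \<open>The element 1 makes the set of gaps nonempty at once.\<close>
    define D where "D = insert 1 ((\<lambda>(\<nu>, \<nu>'). \<beta> \<nu>' - \<beta> \<nu>) ` {(\<nu>, \<nu>'). \<nu> \<subset> \<nu>'})"
    have "finite D" by (simp add: D_def)
    moreover have "D \<noteq> {}" "\<forall>x\<in>D. 0 < x" using inc by (auto simp: D_def)
    moreover have "Min D \<le> \<beta> \<nu>' - \<beta> \<nu>" if "\<nu> \<subset> \<nu>'" for \<nu> \<nu>'
      using that \<open>finite D\<close> by (intro Min_le) (auto simp: D_def)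
    ultimately show ?thesis by (intro that[of "Min D"]) (auto simp: le_diff_eq add.commute)
  qed

  \<comment> \<open>The additional factor 4 absorbs the correction factors in \<open>[1/2, 2]\<close> below.\<close>
  define R :: real where "R = 2 ^ (CARD('r) + 2)"
  \<comment> \<open>The solution of \<open>R * t powr \<delta> = 1\<close>: every strict inclusion
    of faces then lowers \<open>t powr \<beta>\<close> by at least the factor
    \<open>R\<close>.\<close>
  define t where "t = (1 / R) powr (1 / \<delta>)"
  have R: "1 < R" unfolding R_def by (rule one_less_power) auto
  have t: "0 < t" "t < 1"
    using R \<delta> powr_less_mono2[of "1 / \<delta>" "1 / R" 1] by (auto simp: t_def)
  have t\<delta>: "R * t powr \<delta> = 1" using R \<delta> by (simp add: t_def powr_powr)
  have dec: "R * t powr \<beta> \<nu>' \<le> t powr \<beta> \<nu>" if "\<nu> \<subset> \<nu>'" for \<nu> \<nu>'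
  proof -
    have "R * t powr \<beta> \<nu>' \<le> R * t powr (\<beta> \<nu> + \<delta>)"
      using gap[OF that] t R by (intro mult_left_mono powr_mono') auto
    also have "\<dots> = t powr \<beta> \<nu> * (R * t powr \<delta>)" by (simp add: powr_add)
    finally show ?thesis by (simp add: t\<delta>)
  qed
  have masses: "\<exists>z. (\<forall>\<eta>. 0 \<le> z \<eta>) \<and> (\<forall>\<nu>. (\<Sum>\<eta> | \<eta> \<inter> \<nu> = {}. z \<eta>) = t powr \<beta> \<nu> * g \<nu>)"
    if g: "\<And>\<nu>. 1 / 2 \<le> g \<nu> \<and> g \<nu> \<le> 2" for g :: "'r set \<Rightarrow> real"
  proof -
    have nn: "0 \<le> t powr \<beta> \<nu> * g \<nu>" for \<nu> using g[of \<nu>] by simp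
    have gdec: "2 ^ CARD('r) * (t powr \<beta> \<nu>' * g \<nu>') \<le> t powr \<beta> \<nu> * g \<nu>" if "\<nu> \<subset> \<nu>'" for \<nu> \<nu>'
    proof -
      have "2 ^ CARD('r) * (t powr \<beta> \<nu>' * g \<nu>') \<le> 2 ^ CARD('r) * (t powr \<beta> \<nu>' * 2)"
        using g[of \<nu>'] by (intro mult_left_mono) auto
      also have "\<dots> = R * t powr \<beta> \<nu>' / 2" by (simp add: R_def)
      also have "\<dots> \<le> t powr \<beta> \<nu> / 2" using dec[OF that] by (rule divide_right_mono) simp
      also have "\<dots> = t powr \<beta> \<nu> * (1 / 2)" by simp
      also have "\<dots> \<le> t powr \<beta> \<nu> * g \<nu>" using g[of \<nu>] by (intro mult_left_mono) auto
      finally show ?thesis .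
    qed
    show ?thesis
      by (rule ex_vertex_masses[of "\<lambda>\<nu>. t powr \<beta> \<nu> * g \<nu>", OF nn gdec])
  qed

  \<comment> \<open>The stationary vertex copula comes first, since its profile determines how much
    the initial ones must correct.\<close>
  from masses[of "\<lambda>_. 1"] obtain z1 where z1: "\<And>\<eta>. 0 \<le> z1 \<eta>"
    and p1: "\<And>\<nu>. (\<Sum>\<eta> | \<eta> \<inter> \<nu> = {}. z1 \<eta>) = t powr \<beta> \<nu>" by auto
  have lowpow: "t powr \<beta> \<nu> = t ^ card \<nu>" if "card \<nu> \<le> k" for \<nu>
    using low[OF that] t by (simp add: powr_realpow)
  have sum1: "(\<Sum>\<eta>\<in>UNIV. z1 \<eta>) = 1" using p1[of "{}"] lowpow[of "{}"] by simp
  define P where "P \<nu> s = measure (vertex_measure (vec t) z1) (orthant \<nu> s)" for \<nu> s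
  have Pb: "t powr \<beta> \<nu> \<le> P \<nu> s \<and> P \<nu> s \<le> 1" if "t \<le> s" "s \<le> 1" for \<nu> s
  proof -
    interpret prob_space "vertex_measure (vec t) z1"
      using cube_prob_vertex_measure[OF t z1 sum1] by (simp add: cube_prob_def)
    have "P \<nu> t \<le> P \<nu> s"
      unfolding P_def using that by (intro finite_measure_mono) (auto simp: orthant_def intro: order.trans)
    then show ?thesis by (simp add: P_def measure_vertex_measure_orthant[OF t z1] p1)
  qed
  define \<kappa> where "\<kappa> \<nu> = profile_inf (P \<nu>) t (\<beta> \<nu>)" for \<nu>
  \<comment> \<open>The accumulated constant that turns the coefficient
    \<open>\<kappa> \<nu>\<close> into the prescribed \<open>\<alpha> \<nu>\<close>.\<close>
  define K where "K \<nu> = \<alpha> \<nu> / \<kappa> \<nu>" for \<nu>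
  have \<kappa>: "0 < \<kappa> \<nu>" for \<nu>
    unfolding \<kappa>_def by (rule profile_inf_pos[OF t \<beta> Pb])
  have K: "0 < K \<nu>" for \<nu> using \<alpha> \<kappa> by (simp add: K_def)
  \<comment> \<open>This keeps the corrected masses equal to \<open>t ^ card \<nu>\<close> on faces
    of dimension at most \<open>k\<close>, so that the corrected vertex copula still has order
    \<open>k\<close>.\<close>
  have Klow: "K \<nu> = 1" if "card \<nu> \<le> k" for \<nu>
  proof -
    have ratio1: "P \<nu> s / s powr \<beta> \<nu> = 1" if s: "t \<le> s" "s \<le> 1" for s
    proof -
      have "card \<rho> \<le> k" if "\<rho> \<subseteq> \<nu>" for \<rho>
        using card_mono[OF finite that] \<open>card \<nu> \<le> k\<close> by simp
      then have "P \<nu> s = s ^ card \<nu>"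
        unfolding P_def using s t by (intro vertex_measure_orthant_power[OF t z1]) (auto simp: p1 lowpow)
      then show ?thesis using s t low(2)[OF \<open>card \<nu> \<le> k\<close>] by (simp add: powr_realpow)
    qed
    have "\<kappa> \<nu> = (INF s\<in>{t..1}. 1 :: real)"
      unfolding \<kappa>_def profile_inf_def by (intro INF_cong refl ratio1) auto
    then have "\<kappa> \<nu> = 1" using t by simp
    then show ?thesis using low(1)[OF that] by (simp add: K_def)
  qed

  \<comment> \<open>Roots of a positive number tend to 1, so for the finitely many faces a common
    \<open>N\<close> brings all correction factors into the range that \<open>masses\<close>
    admits.\<close>
  have "eventually (\<lambda>N. \<forall>\<nu>\<in>UNIV. 1 / 2 \<le> root N (K \<nu>) \<and> root N (K \<nu>) \<le> 2) sequentially"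
  proof (rule eventually_ball_finite, simp, intro ballI)
    fix \<nu>
    have lim: "(\<lambda>N. root N (K \<nu>)) \<longlonglongrightarrow> 1" by (rule LIMSEQ_root_const[OF K])
    have "eventually (\<lambda>N. 1 / 2 < root N (K \<nu>)) sequentially" "eventually (\<lambda>N. root N (K \<nu>) < 2) sequentially"
      using order_tendstoD(1)[OF lim, of "1/2"] order_tendstoD(2)[OF lim, of 2] by simp_all
    then show "eventually (\<lambda>N. 1 / 2 \<le> root N (K \<nu>) \<and> root N (K \<nu>) \<le> 2) sequentially"
      by eventually_elim simp
  qed
  from eventually_conj[OF this eventually_gt_at_top[of 0]] obtain N
    where N: "0 < N" and root: "\<And>\<nu>. 1 / 2 \<le> root N (K \<nu>) \<and> root N (K \<nu>) \<le> 2"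
    by (auto dest!: eventually_happens)
  from masses[of "\<lambda>\<nu>. root N (K \<nu>)", OF root] obtain z2 where z2: "\<And>\<eta>. 0 \<le> z2 \<eta>"
    and p2: "\<And>\<nu>. (\<Sum>\<eta> | \<eta> \<inter> \<nu> = {}. z2 \<eta>) = t powr \<beta> \<nu> * root N (K \<nu>)" by auto

  define z where "z n = (if n \<le> N then z2 else z1)" for n
  have p: "(\<Sum>\<eta> | \<eta> \<inter> \<nu> = {}. z n \<eta>) = t powr \<beta> \<nu> * (if n \<le> N then root N (K \<nu>) else 1)" for n \<nu>
    by (simp add: z_def p1 p2)
  have z0: "0 \<le> z n \<eta>" for n \<eta> by (simp add: z_def z1 z2)
  have plow: "(\<Sum>\<eta> | \<eta> \<inter> \<rho> = {}. z n \<eta>) = t ^ card \<rho>" if "card \<rho> \<le> k" for n \<rho>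
    using that N by (simp add: p lowpow Klow)
  interpret vertex_seq t z
    using t z0 plow[of "{}"] by unfold_locales auto
  have vc: "z n \<in> vertex_copulas k (vec t)" for n
    by (rule vertex_copulasI[OF t z0 plow])
  have "tchar limit_copula (front_face \<nu>) = (ereal (\<alpha> \<nu>), ereal (\<beta> \<nu>))" for \<nu>
  proof -
    \<comment> \<open>For \<open>N \<le> n\<close> the corrections in the product multiply to
      \<open>K \<nu>\<close>, and the profile belongs to the index \<open>Suc n\<close>, where the
      vertex copula is already \<open>z1\<close>.\<close>
    have "measure limit_copula (orthant \<nu> (t ^ n * s)) = K \<nu> * (t ^ n) powr \<beta> \<nu> * P \<nu> s"
      if n: "N \<le> n" and s: "t \<le> s" "s \<le> 1" for n s
    proof -
      have "(\<Prod>m\<in>{1..n}. \<Sum>\<eta> | \<eta> \<inter> \<nu> = {}. z m \<eta>) = (t powr \<beta> \<nu>) ^ n * (\<Prod>m\<in>{1..n}. if m \<le> N then root N (K \<nu>) else 1)"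
        by (simp add: p prod.distrib)
      also have "(\<Prod>m\<in>{1..n}. if m \<le> N then root N (K \<nu>) else 1) = (\<Prod>m\<in>{1..N}. root N (K \<nu>))"
        using n by (intro prod.mono_neutral_cong_right) auto
      also have "\<dots> = K \<nu>" using K[of \<nu>] N by (simp add: real_root_pow_pos)
      also have "(t powr \<beta> \<nu>) ^ n = (t ^ n) powr \<beta> \<nu>"
        using t by (simp add: powr_realpow[symmetric] powr_powr mult.commute)
      finally show ?thesis
        using n by (simp add: limit_copula_orthant[OF s] P_def z_def)
    qed
    from tchar_eqI[OF cube_prob_limit_copula t \<beta> K this Pb]
    have "tchar limit_copula (front_face \<nu>) = (ereal (K \<nu> * \<kappa> \<nu>), ereal (\<beta> \<nu>))"
      by (simp add: \<kappa>_def)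
    then show ?thesis using \<kappa>[of \<nu>] by (simp add: K_def)
  qed
  then have "\<forall>F\<in>front_faces. tchar limit_copula F = (ereal (a F), ereal (b F))"
    by (auto simp: front_faces_def \<alpha>_def \<beta>_def)
  then show ?thesis
    using t vc is_tnest_limit_limit_copula by (intro exI[of _ t] exI[of _ z] exI[of _ limit_copula]) auto
qed

end
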